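(* Let $\mathcal{M}\supseteq\mathcal{L}\supseteq\mathcal{N}$ be three invariant subspaces of the Bergman shift $B$ with $\dim\mathcal{W}_{\mathcal{M}}=\dim\mathcal{W}_{\mathcal{L}}=\dim\mathcal{W}_{\mathcal{N}}$, and fix orthonormal bases $\{q_k^{\mathcal{M}}\}_k$, $\{q_k^{\mathcal{L}}\}_k$, $\{q_k^{\mathcal{N}}\}_k$ of $\mathcal{W}_{\mathcal{M}}$, $\mathcal{W}_{\mathcal{L}}$, $\mathcal{W}_{\mathcal{N}}$ respectively, all indexed by the same set. Let $T_w^{(\mathcal{M},\mathcal{N})}$, $T_w^{(\mathcal{M},\mathcal{L})}$, $T_w^{(\mathcal{L},\mathcal{N})}$ be the operators defined with respect to these bases. Then for $w\in\partial\mathbb{D}$, $$T_{w}^{(\mathcal{M},\mathcal{N})}=T_{w}^{(\mathcal{L},\mathcal{N})}\,T_{w}^{(\mathcal{M},\mathcal{L})}.$$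
   Context: $\mathbb{D}$ is the open unit disc, $\mathbb{T}=\partial\mathbb{D}$ the unit circle. $H^2(\mathbb{T})$ is the Hardy space of the circle and $H^2(\mathbb{T}^2)=H^2(\mathbb{T})\otimes H^2(\mathbb{T})$ is the Hardy space of the bidisc, with variables $z,w$. Let $p_n(z,w)=\sum_{i=0}^{n}z^iw^{n-i}$ for $n\ge 0$, and let $\mathcal{H}$ be the closed linear span of $\{p_n\}_{n\ge0}$ in $H^2(\mathbb{T}^2)$; equivalently $\mathcal{H}=H^2(\mathbb{T}^2)\ominus[z-w]$, where $[z-w]$ is the closure of $(z-w)H^2(\mathbb{T}^2)$. Let $T_z$ be multiplication by $z$ on $H^2(\mathbb{T}^2)$ and $P_{\mathcal{H}}$ the orthogonal projection onto $\mathcal{H}$. The operator $B=P_{\mathcal{H}}T_z|_{\mathcal{H}}$ on $\mathcal{H}$ is unitarily equivalent to the Bergman shift (multiplication by the coordinate function on the Bergman space $L^2_a(\mathbb{D})$) and is called the Bergman shift here. An invariant subspace of $B$ is a closed subspace $\mathcal{M}\subseteq\mathcal{H}$ with $B\mathcal{M}\subseteq\mathcal{M}$; its wandering subspace is $\mathcal{W}_{\mathcal{M}}=\mathcal{M}\ominus B\mathcal{M}=\mathcal{M}\cap(B\mathcal{M})^{\perp}$. For $q\in\mathcal{H}$, $q(0,w)$ denotes the function in $H^2(\mathbb{T})$ obtained by setting $z=0$, and $T_w^{*j}q(0,w)$ is the result of applying $T_w^{*j}$ to $q(0,\cdot)$, where $T_w^*$ on $H^2(\mathbb{T})$ is the backward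 shift $\sum_{k\ge0}a_kw^k\mapsto\sum_{k\ge0}a_{k+1}w^k$. For $w\in\partial\mathbb{D}$ set $$L_wq=\bigl(q(0,w),\,T_w^{*}q(0,w),\,\dots,\,T_w^{*j}q(0,w),\,\dots\bigr),$$ regarded pointwise in $w$ as an element of $\ell^2(\mathbb{N})$. For an orthonormal basis $\{q_k\}$ of a wandering subspace, the vectors $L_wq_k$ are orthonormal in $\ell^2(\mathbb{N})$ for almost every $w\in\partial\mathbb{D}$; all pointwise statements in $w$ are understood for almost every $w$. Given invariant subspaces $\mathcal{A}\supseteq\mathcal{C}$ of $B$ with $\dim\mathcal{W}_{\mathcal{A}}=\dim\mathcal{W}_{\mathcal{C}}$ and orthonormal bases $\{q_k^{\mathcal{A}}\}$, $\{q_k^{\mathcal{C}}\}$ of $\mathcal{W}_{\mathcal{A}}$, $\mathcal{W}_{\mathcal{C}}$ with the same index set, $T_w^{(\mathcal{A},\mathcal{C})}$ is the bounded linear operator from the closed linear span of $\{L_wq_k^{\mathcal{A}}\}_k$ to the closed linear span of $\{L_wq_k^{\mathcal{C}}\}_k$ in $\ell^2(\mathbb{N})$ determined by $$T_w^{(\mathcal{A},\mathcal{C})}(L_wq_k^{\mathcal{A}})=L_wq_k^{\mathcal{C}}\quad\text{for all }k.$$ *)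

theory Defs
  imports "HOL-Analysis.Analysis"
begin

section \<open>Square-integrable functions\<close>

text \<open>
  Elements of an \<open>L\<^sup>2\<close>-space are represented by functions rather than by their classes modulo
  almost everywhere equality. Every subspace below is closed for the \<open>L\<^sup>2\<close>-seminorm and is
  therefore a union of such classes.
\<close>

definition L2 :: "'a measure \<Rightarrow> ('a \<Rightarrow> complex) set" where
  "L2 M = {f \<in> borel_measurable M. integrable M (\<lambda>x. (cmod (f x))\<^sup>2)}"

definition inner_L2 :: "'a measure \<Rightarrow> ('a \<Rightarrow> complex) \<Rightarrow> ('a \<Rightarrow> complex) \<Rightarrow> complex" where
  "inner_L2 M f g = (\<integral>x. f x * cnj (g x) \<partial>M)"

definition norm_L2 :: "'a measure \<Rightarrow> ('a \<Rightarrow> complex) \<Rightarrow> real" where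
  "norm_L2 M f = sqrt (\<integral>x. (cmod (f x))\<^sup>2 \<partial>M)"

definition closure_L2 :: "'a measure \<Rightarrow> ('a \<Rightarrow> complex) set \<Rightarrow> ('a \<Rightarrow> complex) set" where
  "closure_L2 M S = {f \<in> L2 M. \<forall>e>0. \<exists>g\<in>S. norm_L2 M (\<lambda>x. f x - g x) < e}"

definition complex_span :: "('a \<Rightarrow> complex) set \<Rightarrow> ('a \<Rightarrow> complex) set" where
  "complex_span S = {\<lambda>x. \<Sum>f\<in>F. c f * f x |F c. finite F \<and> F \<subseteq> S}"

definition closed_span :: "'a measure \<Rightarrow> ('a \<Rightarrow> complex) set \<Rightarrow> ('a \<Rightarrow> complex) set" where
  "closed_span M S = closure_L2 M (complex_span S)"

definition closed_subspace :: "'a measure \<Rightarrow> ('a \<Rightarrow> complex) set \<Rightarrow> bool" where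
  "closed_subspace M S \<longleftrightarrow>
     S \<subseteq> L2 M \<and> (\<lambda>x. 0) \<in> S \<and>
     (\<forall>f\<in>S. \<forall>g\<in>S. (\<lambda>x. f x + g x) \<in> S) \<and>
     (\<forall>c. \<forall>f\<in>S. (\<lambda>x. c * f x) \<in> S) \<and>
     closure_L2 M S \<subseteq> S"

text \<open>The orthogonal projection onto \<open>S\<close>; the chosen representative is unique up to a null set.\<close>

definition proj_L2 :: "'a measure \<Rightarrow> ('a \<Rightarrow> complex) set \<Rightarrow> ('a \<Rightarrow> complex) \<Rightarrow> 'a \<Rightarrow> complex" where
  "proj_L2 M S f = (SOME g. g \<in> S \<and> (\<forall>h\<in>S. inner_L2 M (\<lambda>x. f x - g x) h = 0))"

definition orthonormal_basis ::
    "'a measure \<Rightarrow> 'k set \<Rightarrow> ('k \<Rightarrow> 'a \<Rightarrow> complex) \<Rightarrow> ('a \<Rightarrow> complex) set \<Rightarrow> bool" where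
  "orthonormal_basis M K q S \<longleftrightarrow>
     (\<forall>k\<in>K. q k \<in> S) \<and>
     (\<forall>k\<in>K. \<forall>l\<in>K. inner_L2 M (q k) (q l) = (if k = l then 1 else 0)) \<and>
     closed_span M (q ` K) = S"

definition bounded_linear_op ::
    "'a measure \<Rightarrow> ('a \<Rightarrow> complex) set \<Rightarrow> ('a \<Rightarrow> complex) set
      \<Rightarrow> (('a \<Rightarrow> complex) \<Rightarrow> ('a \<Rightarrow> complex)) \<Rightarrow> bool" where
  "bounded_linear_op M S S' T \<longleftrightarrow>
     (\<forall>f\<in>S. T f \<in> S') \<and>
     (\<forall>f\<in>S. \<forall>g\<in>S. T (\<lambda>x. f x + g x) = (\<lambda>x. T f x + T g x)) \<and>
     (\<forall>c. \<forall>f\<in>S. T (\<lambda>x. c * f x) = (\<lambda>x. c * T f x)) \<and>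
     (\<exists>C. \<forall>f\<in>S. norm_L2 M (T f) \<le> C * norm_L2 M f)"


section \<open>The Bergman shift on the bidisc\<close>

text \<open>
  Normalised arc length on the unit circle, as a measure on the complex plane carried by the
  circle; the torus carries the product measure.
\<close>

definition circle :: "complex measure" where
  "circle = distr (uniform_measure lborel {0..2 * pi}) borel cis"

definition torus :: "(complex \<times> complex) measure" where
  "torus = circle \<Otimes>\<^sub>M circle"

definition hardy_torus :: "(complex \<times> complex \<Rightarrow> complex) set" where
  "hardy_torus = {f \<in> L2 torus. \<forall>i j :: int. i < 0 \<or> j < 0 \<longrightarrow>
     inner_L2 torus f (\<lambda>(z, w). z powi i * w powi j) = 0}"

definition p_poly :: "nat \<Rightarrow> complex \<times> complex \<Rightarrow> complex" where
  "p_poly n = (\<lambda>(z, w). \<Sum>i=0..n. z ^ i * w ^ (n - i))"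

definition calH :: "(complex \<times> complex \<Rightarrow> complex) set" where
  "calH = hardy_torus \<inter> closed_span torus (range p_poly)"

definition T_z :: "(complex \<times> complex \<Rightarrow> complex) \<Rightarrow> complex \<times> complex \<Rightarrow> complex" where
  "T_z f = (\<lambda>(z, w). z * f (z, w))"

definition bergman_shift :: "(complex \<times> complex \<Rightarrow> complex) \<Rightarrow> complex \<times> complex \<Rightarrow> complex" where
  "bergman_shift f = proj_L2 torus calH (T_z f)"

definition invariant_subspace :: "(complex \<times> complex \<Rightarrow> complex) set \<Rightarrow> bool" where
  "invariant_subspace X \<longleftrightarrow> X \<subseteq> calH \<and> closed_subspace torus X \<and> bergman_shift ` X \<subseteq> X"

definition wandering :: "(complex \<times> complex \<Rightarrow> complex) set \<Rightarrow> (complex \<times> complex \<Rightarrow> complex) set" where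
  "wandering X = {f \<in> X. \<forall>g \<in> bergman_shift ` X. inner_L2 torus f g = 0}"


section \<open>The operators between the fibres\<close>

text \<open>
  For \<open>q(z,w) = \<Sum> a\<^sub>i\<^sub>j z\<^sup>i w\<^sup>j\<close> in the Hardy space of the bidisc, \<open>q(0,w) = \<Sum> a\<^sub>0\<^sub>j w\<^sup>j\<close> is, for almost
  every \<open>w\<close> on the circle, the zeroth Fourier coefficient of \<open>q(\<sqdot>,w)\<close>: the value at \<open>0\<close> of an
  analytic function is the mean of its boundary values.
\<close>

definition at_z0 :: "(complex \<times> complex \<Rightarrow> complex) \<Rightarrow> complex \<Rightarrow> complex" where
  "at_z0 q = (\<lambda>w. \<integral>z. q (z, w) \<partial>circle)"

text \<open>
  The constant coefficient of \<open>f = \<Sum> a\<^sub>k w\<^sup>k\<close> is its mean over the circle, so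
  \<open>(f(w) - a\<^sub>0) / w = \<Sum> a\<^sub>k\<^sub>+\<^sub>1 w\<^sup>k\<close>.
\<close>

definition backward_shift :: "(complex \<Rightarrow> complex) \<Rightarrow> complex \<Rightarrow> complex" where
  "backward_shift f = (\<lambda>w. (f w - (\<integral>u. f u \<partial>circle)) / w)"

definition Lvec :: "complex \<Rightarrow> (complex \<times> complex \<Rightarrow> complex) \<Rightarrow> nat \<Rightarrow> complex" where
  "Lvec w q = (\<lambda>j. (backward_shift ^^ j) (at_z0 q) w)"

text \<open>\<open>\<ell>\<^sup>2(\<nat>)\<close> is \<open>L\<^sup>2\<close> of the counting measure, where almost everywhere equality is equality.\<close>

abbreviation counting :: "nat measure" where
  "counting \<equiv> count_space UNIV"

definition fibre :: "'k set \<Rightarrow> ('k \<Rightarrow> complex \<times> complex \<Rightarrow> complex) \<Rightarrow> complex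
    \<Rightarrow> (nat \<Rightarrow> complex) set" where
  "fibre K q w = closed_span counting ((\<lambda>k. Lvec w (q k)) ` K)"

text \<open>
  The operator with domain \<open>fibre K qA w\<close>. Outside its domain it is \<open>undefined\<close>, so that it is
  determined uniquely as a HOL function. On the null set of points \<open>w\<close> where the
  vectors \<open>Lvec w (qA k)\<close>, or the vectors \<open>Lvec w (qC k)\<close>, fail to be orthonormal, the operator
  need not exist and its value has no meaning.
\<close>

definition fibre_op :: "'k set \<Rightarrow> ('k \<Rightarrow> complex \<times> complex \<Rightarrow> complex)
    \<Rightarrow> ('k \<Rightarrow> complex \<times> complex \<Rightarrow> complex) \<Rightarrow> complex \<Rightarrow> (nat \<Rightarrow> complex) \<Rightarrow> (nat \<Rightarrow> complex)" where
  "fibre_op K qA qC w = (THE T.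
     T \<in> extensional (fibre K qA w) \<and>
     bounded_linear_op counting (fibre K qA w) (fibre K qC w) T \<and>
     (\<forall>k\<in>K. T (Lvec w (qA k)) = Lvec w (qC k)))"

end

theory Submission imports Defs begin

text \<open>
  For almost every \<open>w\<close> the three families of vectors \<open>L\<^sub>w q\<^sub>k\<close> are orthonormal in \<open>\<ell>\<^sup>2\<close>.
  Once this is known, the theorem is a uniqueness argument in \<open>\<ell>\<^sup>2\<close>. Between the closed spans of
  two orthonormal families with the same index set there is exactly one bounded operator that matches
  the families (\<open>fibre_op_characterization\<close>), and a composition of two such operators matches the
  outer families (\<open>fibre_op_compose\<close>).

  The orthonormality (\<open>AE_orthonormal_Lvec\<close>) comes from the following description of
  \<open>L\<^sub>w q\<close>. The Fourier coefficients of \<open>q\<close> in the closed span of the polynomials \<open>p\<^sub>n\<close>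
  depend only on the total degree: \<open>q(z,w) = \<Sum> a\<^sub>i\<^sub>+\<^sub>j z\<^sup>i w\<^sup>j\<close>. The backward shift in
  \<open>w\<close> therefore turns the coefficient of \<open>z\<^sup>j\<close> into the coefficient of \<open>z\<^sup>j\<^sup>+\<^sup>1\<close>, and
  \<open>L\<^sub>w q\<close> is the sequence of Fourier coefficients in \<open>z\<close> of the slice \<open>q(\<sqdot>,w)\<close>
  (\<open>AE_Lvec_eq\<close>). By Parseval's identity, \<open>\<langle>L\<^sub>w q, L\<^sub>w r\<rangle>\<close> is the integral \<open>G(w)\<close> of
  \<open>q(z,w) cnj (r(z,w))\<close> over \<open>z\<close>. The Fourier coefficients of \<open>G\<close> are
  the numbers \<open>\<langle>w\<^sup>m q, r\<rangle>\<close>. Multiplication by \<open>z\<close> and by \<open>w\<close> have the same compression to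
  the space, since the space is orthogonal to the multiples of \<open>z - w\<close>; hence for \<open>m > 0\<close> one has
  \<open>\<langle>w\<^sup>m q, r\<rangle> = \<langle>B\<^sup>m q, r\<rangle>\<close>, which is zero when \<open>r\<close> is a wandering vector and \<open>q\<close> lies in the
  invariant subspace. For \<open>m < 0\<close> the roles of \<open>q\<close> and \<open>r\<close> are exchanged. So \<open>G\<close> is
  constant almost everywhere by the uniqueness of Fourier coefficients (\<open>AE_circle_zeroI\<close>), with
  value \<open>\<langle>q, r\<rangle>\<close>.

  Orthonormal systems in the space are countable, so one null set serves all pairs of indices. The
  projection in the definition of the shift, and the operators between the fibres, exist by the
  Riesz--Fischer theorem.
\<close>

section \<open>The inner product of square-integrable functions\<close>

lemma L2_iff: "f \<in> L2 M \<longleftrightarrow> f \<in> borel_measurable M \<and> integrable M (\<lambda>x. (cmod (f x))\<^sup>2)"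
  by (simp add: L2_def)

lemma borel_measurable_cnj [measurable (raw)]:
  "f \<in> borel_measurable M \<Longrightarrow> (\<lambda>x. cnj (f x)) \<in> borel_measurable M"
  by (rule borel_measurable_continuous_on[OF continuous_on_cnj[OF continuous_on_id]])

lemma integrable_mult_cnj:
  assumes "f \<in> L2 M" "g \<in> L2 M"
  shows "integrable M (\<lambda>x. f x * cnj (g x))"
proof (rule Bochner_Integration.integrable_bound)
  show "integrable M (\<lambda>x. (cmod (f x))\<^sup>2 + (cmod (g x))\<^sup>2)"
    using assms by (simp add: L2_iff)
  have [measurable]: "f \<in> borel_measurable M" "g \<in> borel_measurable M"
    using assms by (auto simp: L2_iff)
  show "(\<lambda>x. f x * cnj (g x)) \<in> borel_measurable M"
    by measurable
  have "a * b \<le> a\<^sup>2 + b\<^sup>2" if "a \<ge> 0" "b \<ge> 0" for a b :: real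
    using sum_squares_bound[of a b] that mult_nonneg_nonneg[OF that] by linarith
  then show "AE x in M. norm (f x * cnj (g x)) \<le> norm ((cmod (f x))\<^sup>2 + (cmod (g x))\<^sup>2)"
    by (auto simp: norm_mult)
qed

lemma L2_zero [simp]: "(\<lambda>x. 0) \<in> L2 M"
  by (simp add: L2_iff)

lemma L2_add:
  assumes "f \<in> L2 M" "g \<in> L2 M"
  shows "(\<lambda>x. f x + g x) \<in> L2 M"
  unfolding L2_iff
proof
  have [measurable]: "f \<in> borel_measurable M" "g \<in> borel_measurable M"
    using assms by (auto simp: L2_iff)
  show m: "(\<lambda>x. f x + g x) \<in> borel_measurable M" by measurable
  show "integrable M (\<lambda>x. (cmod (f x + g x))\<^sup>2)"
  proof (rule Bochner_Integration.integrable_bound)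
    show "integrable M (\<lambda>x. 2 * (cmod (f x))\<^sup>2 + 2 * (cmod (g x))\<^sup>2)"
      using assms by (simp add: L2_iff)
    have "(cmod (a + b))\<^sup>2 \<le> 2 * (cmod a)\<^sup>2 + 2 * (cmod b)\<^sup>2" for a b
    proof -
      have "(cmod (a + b))\<^sup>2 \<le> (cmod a + cmod b)\<^sup>2"
        by (simp add: norm_triangle_ineq power_mono)
      also have "\<dots> \<le> 2 * (cmod a)\<^sup>2 + 2 * (cmod b)\<^sup>2"
        using sum_squares_bound[of "cmod a" "cmod b"] by (simp add: power2_sum)
      finally show ?thesis .
    qed
    then show "AE x in M. norm ((cmod (f x + g x))\<^sup>2) \<le> norm (2 * (cmod (f x))\<^sup>2 + 2 * (cmod (g x))\<^sup>2)"
      by auto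
  qed measurable
qed

lemma L2_scale: "f \<in> L2 M \<Longrightarrow> (\<lambda>x. c * f x) \<in> L2 M"
  by (auto simp: L2_iff norm_mult power_mult_distrib)

lemma L2_diff: "f \<in> L2 M \<Longrightarrow> g \<in> L2 M \<Longrightarrow> (\<lambda>x. f x - g x) \<in> L2 M"
  using L2_add[of f M "\<lambda>x. (-1) * g x"] L2_scale[of g M "-1"] by simp

lemma L2_sum: "(\<And>i. i \<in> F \<Longrightarrow> f i \<in> L2 M) \<Longrightarrow> (\<lambda>x. \<Sum>i\<in>F. f i x) \<in> L2 M"
  by (induction F rule: infinite_finite_induct) (auto intro: L2_add)

lemma L2_mult_unimodular:
  assumes "f \<in> L2 M" "u \<in> borel_measurable M" "AE x in M. cmod (u x) = 1"
  shows "(\<lambda>x. u x * f x) \<in> L2 M"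
proof -
  have [measurable]: "f \<in> borel_measurable M" "u \<in> borel_measurable M"
    using assms by (auto simp: L2_iff)
  have "integrable M (\<lambda>x. (cmod (u x * f x))\<^sup>2) \<longleftrightarrow> integrable M (\<lambda>x. (cmod (f x))\<^sup>2)"
    by (rule integrable_cong_AE) (use assms(3) in \<open>auto simp: norm_mult\<close>)
  then show ?thesis
    using assms by (simp add: L2_iff)
qed

lemma inner_L2_add_left: "f \<in> L2 M \<Longrightarrow> g \<in> L2 M \<Longrightarrow> h \<in> L2 M \<Longrightarrow>
    inner_L2 M (\<lambda>x. f x + g x) h = inner_L2 M f h + inner_L2 M g h"
  by (simp add: inner_L2_def distrib_right integrable_mult_cnj)

lemma inner_L2_diff_left: "f \<in> L2 M \<Longrightarrow> g \<in> L2 M \<Longrightarrow> h \<in> L2 M \<Longrightarrow>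
    inner_L2 M (\<lambda>x. f x - g x) h = inner_L2 M f h - inner_L2 M g h"
  by (simp add: inner_L2_def left_diff_distrib integrable_mult_cnj)

lemma inner_L2_scale_left: "inner_L2 M (\<lambda>x. c * f x) h = c * inner_L2 M f h"
  by (simp add: inner_L2_def mult.assoc)

lemma inner_L2_cnj: "inner_L2 M g f = cnj (inner_L2 M f g)"
  by (simp add: inner_L2_def mult.commute flip: Bochner_Integration.integral_cnj)

lemma inner_L2_diff_right: "f \<in> L2 M \<Longrightarrow> g \<in> L2 M \<Longrightarrow> h \<in> L2 M \<Longrightarrow>
    inner_L2 M h (\<lambda>x. f x - g x) = inner_L2 M h f - inner_L2 M h g"
  by (simp add: inner_L2_def right_diff_distrib integrable_mult_cnj)

lemma inner_L2_scale_right: "inner_L2 M h (\<lambda>x. c * f x) = cnj c * inner_L2 M h f"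
  by (metis complex_cnj_mult inner_L2_cnj inner_L2_scale_left)

lemma inner_L2_sum_left: "(\<And>i. i \<in> F \<Longrightarrow> f i \<in> L2 M) \<Longrightarrow> h \<in> L2 M \<Longrightarrow>
    inner_L2 M (\<lambda>x. \<Sum>i\<in>F. f i x) h = (\<Sum>i\<in>F. inner_L2 M (f i) h)"
  by (simp add: inner_L2_def sum_distrib_right integrable_mult_cnj)

lemma inner_L2_comb_left: "(\<And>i. i \<in> F \<Longrightarrow> f i \<in> L2 M) \<Longrightarrow> h \<in> L2 M \<Longrightarrow>
    inner_L2 M (\<lambda>x. \<Sum>i\<in>F. c i * f i x) h = (\<Sum>i\<in>F. c i * inner_L2 M (f i) h)"
  by (subst inner_L2_sum_left) (auto intro: L2_scale simp: inner_L2_scale_left)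

lemma norm_L2_nonneg [simp]: "0 \<le> norm_L2 M f"
  by (simp add: norm_L2_def)

lemma norm_L2_power2: "(norm_L2 M f)\<^sup>2 = (\<integral>x. (cmod (f x))\<^sup>2 \<partial>M)"
  by (simp add: norm_L2_def)

lemma inner_L2_self: "inner_L2 M f f = of_real ((norm_L2 M f)\<^sup>2)"
  unfolding norm_L2_power2 inner_L2_def integral_complex_of_real[symmetric]
  by (simp add: complex_norm_square del: of_real_power)

lemma norm_L2_scale: "norm_L2 M (\<lambda>x. c * f x) = cmod c * norm_L2 M f"
  by (simp add: norm_L2_def norm_mult power_mult_distrib real_sqrt_mult)

lemma norm_L2_minus_commute: "norm_L2 M (\<lambda>x. f x - g x) = norm_L2 M (\<lambda>x. g x - f x)"
  by (simp add: norm_L2_def norm_minus_commute)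

lemma norm_L2_diff_power2:
  assumes "f \<in> L2 M" "g \<in> L2 M"
  shows "(norm_L2 M (\<lambda>x. f x - g x))\<^sup>2
    = (norm_L2 M f)\<^sup>2 + (norm_L2 M g)\<^sup>2 - 2 * Re (inner_L2 M f g)"
proof -
  have "complex_of_real ((norm_L2 M (\<lambda>x. f x - g x))\<^sup>2) = inner_L2 M f f + inner_L2 M g g
      - inner_L2 M f g - cnj (inner_L2 M f g)"
    unfolding inner_L2_self[symmetric]
    using assms by (simp add: inner_L2_diff_left inner_L2_diff_right L2_diff
        inner_L2_cnj[of M g f])
  from arg_cong[OF this, of Re] show ?thesis
    by (simp add: inner_L2_self)
qed

lemma norm_L2_add_power2:
  assumes "f \<in> L2 M" "g \<in> L2 M"
  shows "(norm_L2 M (\<lambda>x. f x + g x))\<^sup>2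
    = (norm_L2 M f)\<^sup>2 + (norm_L2 M g)\<^sup>2 + 2 * Re (inner_L2 M f g)"
  using norm_L2_diff_power2[of f M "\<lambda>x. (-1) * g x"] assms L2_scale[of g M "-1"]
    norm_L2_scale[of M "-1" g] inner_L2_scale_right[of M f "-1" g]
  by simp

lemma Cauchy_Schwarz_L2:
  assumes f: "f \<in> L2 M" and g: "g \<in> L2 M"
  shows "cmod (inner_L2 M f g) \<le> norm_L2 M f * norm_L2 M g"
proof (cases "norm_L2 M g = 0")
  case True
  then have "(\<integral>x. (cmod (g x))\<^sup>2 \<partial>M) = 0"
    by (simp add: norm_L2_def)
  then have "AE x in M. g x = 0"
    using g by (subst (asm) integral_nonneg_eq_0_iff_AE) (auto simp: L2_iff)
  then have "inner_L2 M f g = 0"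
    unfolding inner_L2_def by (intro integral_eq_zero_AE) auto
  then show ?thesis by simp
next
  case False
  then have pos: "norm_L2 M g > 0"
    using norm_L2_nonneg[of M g] by linarith
  \<comment> \<open>\<open>t * g\<close> is the projection of \<open>f\<close> onto the line through \<open>g\<close>.\<close>
  define t where "t = inner_L2 M f g / of_real ((norm_L2 M g)\<^sup>2)"
  have "0 \<le> (norm_L2 M (\<lambda>x. f x - t * g x))\<^sup>2" by simp
  also have "\<dots> = (norm_L2 M f)\<^sup>2 + (cmod t * norm_L2 M g)\<^sup>2 - 2 * Re (cnj t * inner_L2 M f g)"
    using norm_L2_diff_power2[OF f L2_scale[OF g, of t]]
    by (simp add: norm_L2_scale inner_L2_scale_right)
  also have "cmod t * norm_L2 M g = cmod (inner_L2 M f g) / norm_L2 M g"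
    using pos by (simp add: t_def norm_divide norm_power norm_mult power2_eq_square)
  also have "Re (cnj t * inner_L2 M f g) = (cmod (inner_L2 M f g) / norm_L2 M g)\<^sup>2"
  proof -
    have "cnj t * inner_L2 M f g = of_real ((cmod (inner_L2 M f g))\<^sup>2 / (norm_L2 M g)\<^sup>2)"
      by (simp add: t_def complex_norm_square mult.commute flip: of_real_power del: of_real_power)
    then show ?thesis by (simp add: power_divide)
  qed
  finally have "(cmod (inner_L2 M f g) / norm_L2 M g)\<^sup>2 \<le> (norm_L2 M f)\<^sup>2" by simp
  then have "cmod (inner_L2 M f g) / norm_L2 M g \<le> norm_L2 M f"
    by (rule power2_le_imp_le) simp
  then show ?thesis using pos by (simp add: divide_le_eq)
qed

lemma norm_L2_triangle:
  assumes "f \<in> L2 M" "g \<in> L2 M"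
  shows "norm_L2 M (\<lambda>x. f x + g x) \<le> norm_L2 M f + norm_L2 M g"
proof (rule power2_le_imp_le)
  have "Re (inner_L2 M f g) \<le> norm_L2 M f * norm_L2 M g"
    using Cauchy_Schwarz_L2[OF assms] complex_Re_le_cmod order_trans by blast
  then show "(norm_L2 M (\<lambda>x. f x + g x))\<^sup>2 \<le> (norm_L2 M f + norm_L2 M g)\<^sup>2"
    using norm_L2_add_power2[OF assms] by (simp add: power2_sum)
qed simp

lemma norm_L2_triangle_diff:
  assumes "f \<in> L2 M" "g \<in> L2 M" "h \<in> L2 M"
  shows "norm_L2 M (\<lambda>x. f x - h x) \<le> norm_L2 M (\<lambda>x. f x - g x) + norm_L2 M (\<lambda>x. g x - h x)"
  using norm_L2_triangle[of "\<lambda>x. f x - g x" M "\<lambda>x. g x - h x"] assms by (simp add: L2_diff)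

lemma tendsto_inner_L2:
  assumes s: "\<And>n. s n \<in> L2 M" and f: "f \<in> L2 M" and g: "g \<in> L2 M"
    and lim: "(\<lambda>n. norm_L2 M (\<lambda>x. f x - s n x)) \<longlonglongrightarrow> 0"
  shows "(\<lambda>n. inner_L2 M (s n) g) \<longlonglongrightarrow> inner_L2 M f g"
proof (rule Lim_transform)
  show "(\<lambda>n. inner_L2 M f g) \<longlonglongrightarrow> inner_L2 M f g" by simp
  show "(\<lambda>n. inner_L2 M (s n) g - inner_L2 M f g) \<longlonglongrightarrow> 0"
  proof (rule Lim_null_comparison)
    show "\<forall>\<^sub>F n in sequentially. cmod (inner_L2 M (s n) g - inner_L2 M f g)
        \<le> norm_L2 M (\<lambda>x. f x - s n x) * norm_L2 M g"
      using Cauchy_Schwarz_L2[OF L2_diff[OF f s] g] f g s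
      by (simp add: inner_L2_diff_left norm_minus_commute)
    show "(\<lambda>n. norm_L2 M (\<lambda>x. f x - s n x) * norm_L2 M g) \<longlonglongrightarrow> 0"
      using tendsto_mult_right[OF lim] by simp
  qed
qed

section \<open>Linear spans and their closures\<close>

lemma complex_span_base: "f \<in> S \<Longrightarrow> f \<in> complex_span S"
  unfolding complex_span_def
  by (rule CollectI, rule exI[of _ "{f}"], rule exI[of _ "\<lambda>_. 1"]) simp

lemma complex_span_add:
  assumes "f \<in> complex_span S" "g \<in> complex_span S"
  shows "(\<lambda>x. f x + g x) \<in> complex_span S"
proof -
  from assms obtain F c G d where F: "finite F" "F \<subseteq> S" "f = (\<lambda>x. \<Sum>h\<in>F. c h * h x)"
    and G: "finite G" "G \<subseteq> S" "g = (\<lambda>x. \<Sum>h\<in>G. d h * h x)"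
    unfolding complex_span_def by blast
  define e where "e h = (if h \<in> F then c h else 0) + (if h \<in> G then d h else 0)" for h
  have "f x + g x = (\<Sum>h\<in>F \<union> G. e h * h x)" for x
  proof -
    have "f x = (\<Sum>h\<in>F \<union> G. (if h \<in> F then c h else 0) * h x)"
      unfolding F(3) by (rule sum.mono_neutral_cong_left) (use F G in auto)
    moreover have "g x = (\<Sum>h\<in>F \<union> G. (if h \<in> G then d h else 0) * h x)"
      unfolding G(3) by (rule sum.mono_neutral_cong_left) (use F G in auto)
    ultimately show ?thesis
      by (simp add: e_def distrib_right sum.distrib)
  qed
  then have "(\<lambda>x. f x + g x) = (\<lambda>x. \<Sum>h\<in>F \<union> G. e h * h x)" by (rule ext)
  moreover have "finite (F \<union> G)" "F \<union> G \<subseteq> S" using F G by auto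
  ultimately show ?thesis unfolding complex_span_def by blast
qed

lemma complex_span_scale:
  assumes "f \<in> complex_span S"
  shows "(\<lambda>x. a * f x) \<in> complex_span S"
proof -
  from assms obtain F c where F: "finite F" "F \<subseteq> S" "f = (\<lambda>x. \<Sum>h\<in>F. c h * h x)"
    unfolding complex_span_def by blast
  have "(\<lambda>x. a * f x) = (\<lambda>x. \<Sum>h\<in>F. (a * c h) * h x)"
    unfolding F(3) by (simp add: sum_distrib_left mult.assoc)
  then show ?thesis using F unfolding complex_span_def
    by (intro CollectI exI[of _ F] exI[of _ "\<lambda>h. a * c h"]) auto
qed

lemma complex_span_zero: "(\<lambda>x. 0) \<in> complex_span S"
  unfolding complex_span_def by (rule CollectI, rule exI[of _ "{}"]) auto

lemma complex_span_sum:
  assumes "\<And>i. i \<in> F \<Longrightarrow> f i \<in> complex_span S"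
  shows "(\<lambda>x. \<Sum>i\<in>F. c i * f i x) \<in> complex_span S"
  using assms
proof (induction F rule: infinite_finite_induct)
  case (insert i F)
  have "(\<lambda>x. c i * f i x + (\<Sum>i\<in>F. c i * f i x)) \<in> complex_span S"
    by (rule complex_span_add[OF complex_span_scale]) (use insert in auto)
  then show ?case using insert by simp
qed (simp_all add: complex_span_zero)

text \<open>
  A linear combination of a family, given with a finite set of members, can be reindexed by finitely
  many indices with one index for each member, even if the family repeats a member.
\<close>

lemma complex_span_image_comb:
  assumes "h \<in> complex_span (b ` K)"
  obtains F c where "finite F" "F \<subseteq> K" "h = (\<lambda>x. \<Sum>k\<in>F. c k * b k x)"
proof -
  from assms obtain G d where G: "finite G" "G \<subseteq> b ` K" "h = (\<lambda>x. \<Sum>f\<in>G. d f * f x)"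
    unfolding complex_span_def by blast
  from G(2) obtain F where F: "F \<subseteq> K" "inj_on b F" "G = b ` F"
    by (meson subset_image_inj)
  have "finite F" using F G finite_imageD by blast
  moreover have "h = (\<lambda>x. \<Sum>k\<in>F. d (b k) * b k x)"
    unfolding G(3) F(3) by (simp add: sum.reindex[OF F(2)])
  ultimately show ?thesis by (rule that[OF _ F(1)])
qed

lemma complex_span_L2: "S \<subseteq> L2 M \<Longrightarrow> complex_span S \<subseteq> L2 M"
  unfolding complex_span_def by (auto intro!: L2_sum L2_scale)

lemma closed_span_L2: "closed_span M S \<subseteq> L2 M"
  by (auto simp: closed_span_def closure_L2_def)

lemma closed_spanD: "f \<in> closed_span M S \<Longrightarrow> e > 0 \<Longrightarrow>
    \<exists>g\<in>complex_span S. norm_L2 M (\<lambda>x. f x - g x) < e"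
  by (auto simp: closed_span_def closure_L2_def)

lemma closed_spanI: "f \<in> L2 M \<Longrightarrow> (\<And>e. e > 0 \<Longrightarrow> \<exists>g\<in>complex_span S. norm_L2 M (\<lambda>x. f x - g x) < e)
    \<Longrightarrow> f \<in> closed_span M S"
  by (auto simp: closed_span_def closure_L2_def)

lemma complex_span_subset_closed_span:
  assumes "S \<subseteq> L2 M"
  shows "complex_span S \<subseteq> closed_span M S"
proof
  fix f assume f: "f \<in> complex_span S"
  then have "f \<in> L2 M" using complex_span_L2[OF assms] by blast
  then show "f \<in> closed_span M S"
  proof (rule closed_spanI)
    fix e :: real assume "e > 0"
    then show "\<exists>g\<in>complex_span S. norm_L2 M (\<lambda>x. f x - g x) < e"
      using f by (intro bexI[of _ f]) (simp_all add: norm_L2_def)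
  qed
qed

lemma closed_span_add:
  assumes S: "S \<subseteq> L2 M" and f: "f \<in> closed_span M S" and g: "g \<in> closed_span M S"
  shows "(\<lambda>x. f x + g x) \<in> closed_span M S"
proof (rule closed_spanI)
  note L = f[THEN closed_span_L2[THEN subsetD]] g[THEN closed_span_L2[THEN subsetD]]
  show "(\<lambda>x. f x + g x) \<in> L2 M" using L by (rule L2_add)
  fix e :: real assume "e > 0"
  then obtain u v where u: "u \<in> complex_span S" "norm_L2 M (\<lambda>x. f x - u x) < e / 2"
    and v: "v \<in> complex_span S" "norm_L2 M (\<lambda>x. g x - v x) < e / 2"
    using closed_spanD[OF f, of "e/2"] closed_spanD[OF g, of "e/2"] by auto
  have uv: "u \<in> L2 M" "v \<in> L2 M" using u v complex_span_L2[OF S] by auto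
  have "norm_L2 M (\<lambda>x. (f x + g x) - (u x + v x))
      \<le> norm_L2 M (\<lambda>x. f x - u x) + norm_L2 M (\<lambda>x. g x - v x)"
    using norm_L2_triangle[OF L2_diff[OF L(1) uv(1)] L2_diff[OF L(2) uv(2)]]
    by (simp add: algebra_simps)
  also have "\<dots> < e" using u v by simp
  finally show "\<exists>h\<in>complex_span S. norm_L2 M (\<lambda>x. f x + g x - h x) < e"
    using complex_span_add[OF u(1) v(1)] by (rule bexI)
qed

lemma closed_span_scale:
  assumes f: "f \<in> closed_span M S"
  shows "(\<lambda>x. a * f x) \<in> closed_span M S"
proof (rule closed_spanI)
  show "(\<lambda>x. a * f x) \<in> L2 M" using f closed_span_L2 by (blast intro: L2_scale)
  fix e :: real assume e: "e > 0"
  define d where "d = e / (cmod a + 1)"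
  have "cmod a + 1 > 0" using norm_ge_zero[of a] by linarith
  then have "d > 0" using e by (simp add: d_def)
  then obtain u where u: "u \<in> complex_span S" "norm_L2 M (\<lambda>x. f x - u x) < d"
    using closed_spanD[OF f] by auto
  have "norm_L2 M (\<lambda>x. a * f x - a * u x) = cmod a * norm_L2 M (\<lambda>x. f x - u x)"
    using norm_L2_scale[of M a "\<lambda>x. f x - u x"] by (simp add: algebra_simps)
  also have "\<dots> \<le> cmod a * d" using u by (intro mult_left_mono) auto
  also have "\<dots> < (cmod a + 1) * d" using \<open>d > 0\<close> by simp
  also have "\<dots> = e" using \<open>cmod a + 1 > 0\<close> by (simp add: d_def)
  finally show "\<exists>h\<in>complex_span S. norm_L2 M (\<lambda>x. a * f x - h x) < e"
    using complex_span_scale[OF u(1)] by (rule bexI)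
qed

lemma closed_span_approx:
  assumes "f \<in> closed_span M S"
  obtains s where "\<And>n. s n \<in> complex_span S" "(\<lambda>n. norm_L2 M (\<lambda>x. f x - s n x)) \<longlonglongrightarrow> 0"
proof -
  have "\<forall>n. \<exists>g\<in>complex_span S. norm_L2 M (\<lambda>x. f x - g x) < inverse (real (Suc n))"
    using closed_spanD[OF assms] by (simp del: of_nat_Suc)
  then obtain s where s: "\<And>n. s n \<in> complex_span S"
      "\<And>n. norm_L2 M (\<lambda>x. f x - s n x) < inverse (real (Suc n))" by metis
  have "(\<lambda>n. norm_L2 M (\<lambda>x. f x - s n x)) \<longlonglongrightarrow> 0"
    by (rule real_tendsto_sandwich[OF _ _ tendsto_const LIMSEQ_inverse_real_of_nat])
       (use s(2) in \<open>auto intro!: always_eventually less_imp_le simp del: of_nat_Suc\<close>)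
  with s(1) show ?thesis by (rule that)
qed

lemma closed_span_lim:
  assumes "S \<subseteq> L2 M" "f \<in> L2 M" "\<And>n. s n \<in> complex_span S" "(\<lambda>n. norm_L2 M (\<lambda>x. f x - s n x)) \<longlonglongrightarrow> 0"
  shows "f \<in> closed_span M S"
proof (rule closed_spanI)
  fix e :: real assume "e > 0"
  then have "\<forall>\<^sub>F n in sequentially. norm_L2 M (\<lambda>x. f x - s n x) < e"
    using order_tendstoD(2)[OF assms(4)] by blast
  then show "\<exists>g\<in>complex_span S. norm_L2 M (\<lambda>x. f x - g x) < e"
    using assms(3) by (meson eventually_happens sequentially_bot)
qed fact

text \<open>
  Orthogonality to the generators passes to finite combinations by linearity and to limits by the
  Cauchy--Schwarz inequality.
\<close>

lemma closed_span_orthogonal: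
  assumes S: "S \<subseteq> L2 M" and g: "g \<in> L2 M" and orth: "\<And>s. s \<in> S \<Longrightarrow> inner_L2 M s g = 0"
    and f: "f \<in> closed_span M S"
  shows "inner_L2 M f g = 0"
proof -
  obtain s where s: "\<And>n. s n \<in> complex_span S" "(\<lambda>n. norm_L2 M (\<lambda>x. f x - s n x)) \<longlonglongrightarrow> 0"
    using closed_span_approx[OF f] by blast
  have "inner_L2 M h g = 0" if h: "h \<in> complex_span S" for h
  proof -
    obtain F c where F: "finite F" "F \<subseteq> S" "h = (\<lambda>x. \<Sum>k\<in>F. c k * k x)"
      using h unfolding complex_span_def by blast
    have "inner_L2 M h g = (\<Sum>k\<in>F. c k * inner_L2 M k g)"
      unfolding F(3) by (rule inner_L2_comb_left) (use F S g in auto)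
    then show ?thesis using orth F by (simp add: subset_iff)
  qed
  moreover have "(\<lambda>n. inner_L2 M (s n) g) \<longlonglongrightarrow> inner_L2 M f g"
    by (rule tendsto_inner_L2) (use s complex_span_L2[OF S] closed_span_L2 f g in blast)+
  ultimately show ?thesis using s(1) by (simp add: LIMSEQ_const_iff)
qed

section \<open>Orthonormal families\<close>

definition orthonormal_family :: "'a measure \<Rightarrow> 'k set \<Rightarrow> ('k \<Rightarrow> 'a \<Rightarrow> complex) \<Rightarrow> bool" where
  "orthonormal_family M K b \<longleftrightarrow> (\<forall>k\<in>K. b k \<in> L2 M) \<and>
     (\<forall>k\<in>K. \<forall>l\<in>K. inner_L2 M (b k) (b l) = (if k = l then 1 else 0))"

lemma orthonormal_familyD:
  assumes "orthonormal_family M K b"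
  shows "k \<in> K \<Longrightarrow> b k \<in> L2 M" "b ` K \<subseteq> L2 M"
    "k \<in> K \<Longrightarrow> l \<in> K \<Longrightarrow> inner_L2 M (b k) (b l) = (if k = l then 1 else 0)"
  using assms by (auto simp: orthonormal_family_def)

lemma orthonormal_comb_L2: "orthonormal_family M K b \<Longrightarrow> F \<subseteq> K \<Longrightarrow> (\<lambda>x. \<Sum>k\<in>F. c k * b k x) \<in> L2 M"
  by (intro L2_sum L2_scale) (auto simp: orthonormal_family_def)

lemma orthonormal_comb_span: "F \<subseteq> K \<Longrightarrow> (\<lambda>x. \<Sum>k\<in>F. c k * b k x) \<in> complex_span (b ` K)"
  by (intro complex_span_sum complex_span_base) auto

lemma orthonormal_comb_inner:
  assumes "orthonormal_family M K b" "finite F" "F \<subseteq> K" "l \<in> K"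
  shows "inner_L2 M (\<lambda>x. \<Sum>k\<in>F. c k * b k x) (b l) = (if l \<in> F then c l else 0)"
proof -
  have "inner_L2 M (\<lambda>x. \<Sum>k\<in>F. c k * b k x) (b l) = (\<Sum>k\<in>F. c k * inner_L2 M (b k) (b l))"
    by (rule inner_L2_comb_left) (use assms in \<open>auto simp: orthonormal_family_def\<close>)
  also have "\<dots> = (\<Sum>k\<in>F. if k = l then c k else 0)"
    by (rule sum.cong) (use assms in \<open>auto simp: orthonormal_family_def\<close>)
  finally show ?thesis using assms(2) by simp
qed

lemma orthonormal_comb_norm:
  assumes b: "orthonormal_family M K b" and F: "finite F" "F \<subseteq> K"
  shows "(norm_L2 M (\<lambda>x. \<Sum>k\<in>F. c k * b k x))\<^sup>2 = (\<Sum>k\<in>F. (cmod (c k))\<^sup>2)"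
proof -
  let ?h = "\<lambda>x. \<Sum>k\<in>F. c k * b k x"
  have "complex_of_real ((norm_L2 M ?h)\<^sup>2) = (\<Sum>k\<in>F. c k * inner_L2 M (b k) ?h)"
    unfolding inner_L2_self[symmetric]
    by (rule inner_L2_comb_left)
       (use F orthonormal_comb_L2[OF b F(2)] orthonormal_familyD[OF b] in auto)
  also have "\<dots> = (\<Sum>k\<in>F. complex_of_real ((cmod (c k))\<^sup>2))"
  proof (rule sum.cong)
    fix k assume "k \<in> F"
    then show "c k * inner_L2 M (b k) ?h = complex_of_real ((cmod (c k))\<^sup>2)"
      using F orthonormal_comb_inner[OF b F, of k c]
      by (subst inner_L2_cnj) (auto simp: complex_norm_square simp del: of_real_power)
  qed simp
  finally show ?thesis by (simp flip: of_real_sum del: of_real_power)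
qed

text \<open>
  Completing the square in the coefficients. Taking \<open>c k\<close> to be the coefficients of \<open>f\<close> gives
  Bessel's inequality, and comparing them with any other choice shows that they give the best
  approximation.
\<close>

lemma orthonormal_approx_identity:
  assumes b: "orthonormal_family M K b" and F: "finite F" "F \<subseteq> K" and f: "f \<in> L2 M"
  shows "(norm_L2 M (\<lambda>x. f x - (\<Sum>k\<in>F. c k * b k x)))\<^sup>2 = (norm_L2 M f)\<^sup>2
    - (\<Sum>k\<in>F. (cmod (inner_L2 M f (b k)))\<^sup>2) + (\<Sum>k\<in>F. (cmod (inner_L2 M f (b k) - c k))\<^sup>2)"
proof -
  let ?h = "\<lambda>x. \<Sum>k\<in>F. c k * b k x"
  have h: "?h \<in> L2 M" using b F(2) by (rule orthonormal_comb_L2)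
  have "inner_L2 M ?h f = (\<Sum>k\<in>F. c k * inner_L2 M (b k) f)"
    by (rule inner_L2_comb_left) (use F f orthonormal_familyD[OF b] in auto)
  then have "inner_L2 M f ?h = (\<Sum>k\<in>F. cnj (c k) * inner_L2 M f (b k))"
    by (subst inner_L2_cnj) (simp add: inner_L2_cnj[of M f])
  then have *: "Re (inner_L2 M f ?h) = (\<Sum>k\<in>F. Re (cnj (c k) * inner_L2 M f (b k)))"
    by simp
  have sq: "(cmod (a - d))\<^sup>2 = (cmod a)\<^sup>2 + (cmod d)\<^sup>2 - 2 * Re (cnj d * a)" for a d
    by (simp only: cmod_power2) (simp add: power2_eq_square algebra_simps)
  show ?thesis
    unfolding norm_L2_diff_power2[OF f h] orthonormal_comb_norm[OF b F] * sq
    by (simp add: sum.distrib sum_subtractf sum_distrib_left del: complex_cnj_mult times_complex.simps)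
qed

lemma Bessel_inequality:
  assumes "orthonormal_family M K b" "finite F" "F \<subseteq> K" "f \<in> L2 M"
  shows "(\<Sum>k\<in>F. (cmod (inner_L2 M f (b k)))\<^sup>2) \<le> (norm_L2 M f)\<^sup>2"
  using orthonormal_approx_identity[OF assms, of "\<lambda>k. inner_L2 M f (b k)"]
    zero_le_power2[of "norm_L2 M (\<lambda>x. f x - (\<Sum>k\<in>F. inner_L2 M f (b k) * b k x))"]
  by simp

lemma orthonormal_best_approx:
  assumes b: "orthonormal_family M K b" and F: "finite F" "F \<subseteq> K" and f: "f \<in> L2 M"
    and F': "F' \<subseteq> F"
  shows "norm_L2 M (\<lambda>x. f x - (\<Sum>k\<in>F. inner_L2 M f (b k) * b k x))
    \<le> norm_L2 M (\<lambda>x. f x - (\<Sum>k\<in>F'. c k * b k x))"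
proof -
  let ?d = "\<lambda>k. if k \<in> F' then c k else 0"
  have "(\<Sum>k\<in>F'. c k * b k x) = (\<Sum>k\<in>F. ?d k * b k x)" for x
    by (rule sum.mono_neutral_cong_left) (use F F' in auto)
  moreover have "(norm_L2 M (\<lambda>x. f x - (\<Sum>k\<in>F. inner_L2 M f (b k) * b k x)))\<^sup>2
    \<le> (norm_L2 M (\<lambda>x. f x - (\<Sum>k\<in>F. ?d k * b k x)))\<^sup>2"
    unfolding orthonormal_approx_identity[OF b F f]
    by (simp add: sum_nonneg)
  ultimately show ?thesis
    using power2_le_imp_le[OF _ norm_L2_nonneg] by simp
qed

lemma closed_span_orthonormal_approx:
  assumes b: "orthonormal_family M K b" and f: "f \<in> closed_span M (b ` K)" and e: "e > 0"
  shows "\<exists>F. finite F \<and> F \<subseteq> K \<and> (\<forall>G. finite G \<longrightarrow> F \<subseteq> G \<longrightarrow> G \<subseteq> K \<longrightarrow>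
    norm_L2 M (\<lambda>x. f x - (\<Sum>k\<in>G. inner_L2 M f (b k) * b k x)) < e)"
proof -
  obtain h where h: "h \<in> complex_span (b ` K)" "norm_L2 M (\<lambda>x. f x - h x) < e"
    using closed_spanD[OF f e] by blast
  obtain F c where F: "finite F" "F \<subseteq> K" "h = (\<lambda>x. \<Sum>k\<in>F. c k * b k x)"
    using complex_span_image_comb[OF h(1)] by blast
  have "norm_L2 M (\<lambda>x. f x - (\<Sum>k\<in>G. inner_L2 M f (b k) * b k x)) < e"
    if G: "finite G" "F \<subseteq> G" "G \<subseteq> K" for G
  proof -
    have "norm_L2 M (\<lambda>x. f x - (\<Sum>k\<in>G. inner_L2 M f (b k) * b k x)) \<le> norm_L2 M (\<lambda>x. f x - h x)"
      unfolding F(3)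
      by (rule orthonormal_best_approx[OF b G(1,3) _ G(2)]) (use f closed_span_L2 in blast)
    then show ?thesis using h(2) by linarith
  qed
  with F(1,2) show ?thesis by (intro exI[of _ F]) simp
qed

section \<open>Completeness, Riesz--Fischer and Parseval\<close>

lemma nn_integral_norm_L2:
  assumes "f \<in> L2 M"
  shows "(\<integral>\<^sup>+x. ennreal ((cmod (f x))\<^sup>2) \<partial>M) = ennreal ((norm_L2 M f)\<^sup>2)"
  using assms unfolding norm_L2_power2 by (intro nn_integral_eq_integral) (auto simp: L2_iff)

lemma L2I_nn_integral:
  assumes [measurable]: "f \<in> borel_measurable M"
    and "(\<integral>\<^sup>+x. ennreal ((cmod (f x))\<^sup>2) \<partial>M) \<le> ennreal (C\<^sup>2)" "0 \<le> C"
  shows "f \<in> L2 M" "norm_L2 M f \<le> C"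
proof -
  have "integrable M (\<lambda>x. (cmod (f x))\<^sup>2)"
    by (rule integrableI_bounded)
       (use assms(2) in \<open>auto intro: order_le_less_trans\<close>)
  then show f: "f \<in> L2 M" by (simp add: L2_iff)
  have "(norm_L2 M f)\<^sup>2 \<le> C\<^sup>2"
    using assms(2) unfolding nn_integral_norm_L2[OF f] by (simp add: ennreal_le_iff)
  then show "norm_L2 M f \<le> C" using assms(3) by (rule power2_le_imp_le)
qed

text \<open>
  The \<open>L\<^sup>2\<close> norms of the partial sums of \<open>\<Sum> |f\<^sub>n\<^sub>+\<^sub>1 - f\<^sub>n|\<close> are bounded by \<open>2\<close>, so by monotone
  convergence this series is finite almost everywhere. The sequence therefore has a pointwise limit,
  and Fatou's lemma turns the bounds on \<open>f\<^sub>n\<^sub>+\<^sub>k - f\<^sub>n\<close> into a bound on the distance to that limit.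
\<close>

lemma L2_complete:
  assumes f: "\<And>n. f n \<in> L2 M"
    and fast: "\<And>n. norm_L2 M (\<lambda>x. f (Suc n) x - f n x) \<le> (1/2) ^ n"
  obtains g where "g \<in> L2 M" "(\<lambda>n. norm_L2 M (\<lambda>x. g x - f n x)) \<longlonglongrightarrow> 0"
proof -
  define d where "d n x = f (Suc n) x - f n x" for n x
  define h where "h N x = (\<Sum>n<N. cmod (d n x))" for N x
  have [measurable]: "\<And>n. f n \<in> borel_measurable M" using f by (auto simp: L2_iff)
  have d: "d n \<in> L2 M" "norm_L2 M (d n) \<le> (1/2) ^ n" for n
    using L2_diff[OF f f] fast unfolding d_def by auto
  have [measurable]: "\<And>n. d n \<in> borel_measurable M" using d by (auto simp: L2_iff)
  have [measurable]: "\<And>n. h n \<in> borel_measurable M" unfolding h_def by measurable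
  have h: "(\<lambda>x. complex_of_real (h N x)) \<in> L2 M \<and>
      norm_L2 M (\<lambda>x. complex_of_real (h N x)) \<le> 2 - 2 * (1/2) ^ N" for N
  proof (induction N)
    case 0
    then show ?case by (simp add: h_def norm_L2_def)
  next
    case (Suc N)
    have dN: "(\<lambda>x. complex_of_real (cmod (d N x))) \<in> L2 M"
      using d(1)[of N] by (simp add: L2_iff)
    moreover have "norm_L2 M (\<lambda>x. complex_of_real (cmod (d N x))) \<le> (1/2) ^ N"
      using d(2)[of N] by (simp add: norm_L2_def)
    ultimately show ?case
      using Suc norm_L2_triangle[of "\<lambda>x. complex_of_real (h N x)" M "\<lambda>x. complex_of_real (cmod (d N x))"]
        L2_add[of "\<lambda>x. complex_of_real (h N x)" M "\<lambda>x. complex_of_real (cmod (d N x))"]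
      by (simp add: h_def)
  qed
  have h4: "(\<integral>\<^sup>+x. ennreal ((h N x)\<^sup>2) \<partial>M) \<le> ennreal 4" for N
  proof -
    have "(\<integral>\<^sup>+x. ennreal ((h N x)\<^sup>2) \<partial>M) = ennreal ((norm_L2 M (\<lambda>x. complex_of_real (h N x)))\<^sup>2)"
      using nn_integral_norm_L2[OF conjunct1[OF h[of N]]] by simp
    also have "\<dots> \<le> ennreal (2\<^sup>2)"
    proof (intro ennreal_leI power_mono)
      have "0 \<le> 2 * (1/2::real) ^ N" by simp
      then show "norm_L2 M (\<lambda>x. complex_of_real (h N x)) \<le> 2" using h[of N] by linarith
    qed simp
    finally show ?thesis by simp
  qed
  have inc: "incseq (\<lambda>N. \<lambda>x. ennreal ((h N x)\<^sup>2))"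
  proof (intro incseq_SucI le_funI ennreal_leI power_mono)
    show "h N x \<le> h (Suc N) x" "0 \<le> h N x" for N x by (simp_all add: h_def sum_nonneg)
  qed
  have "(\<integral>\<^sup>+x. (SUP N. ennreal ((h N x)\<^sup>2)) \<partial>M) = (SUP N. \<integral>\<^sup>+x. ennreal ((h N x)\<^sup>2) \<partial>M)"
    by (rule nn_integral_monotone_convergence_SUP[OF inc]) measurable
  also have "\<dots> \<le> ennreal 4" by (rule SUP_least) (rule h4)
  finally have "(\<integral>\<^sup>+x. (SUP N. ennreal ((h N x)\<^sup>2)) \<partial>M) \<noteq> \<infinity>"
    by (metis ennreal_less_top infinity_ennreal_def linorder_not_less top.not_eq_extremum)
  then have fin: "AE x in M. (SUP N. ennreal ((h N x)\<^sup>2)) \<noteq> \<infinity>"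
    by (intro nn_integral_PInf_AE) measurable
  have conv: "AE x in M. convergent (\<lambda>n. f n x)"
    using fin
  proof eventually_elim
    fix x assume "(SUP N. ennreal ((h N x)\<^sup>2)) \<noteq> \<infinity>"
    then obtain B where B: "(SUP N. ennreal ((h N x)\<^sup>2)) = ennreal B" "0 \<le> B"
      by (metis ennreal_cases infinity_ennreal_def)
    have "h N x \<le> sqrt B" for N
    proof -
      have "ennreal ((h N x)\<^sup>2) \<le> ennreal B" unfolding B(1)[symmetric] by (rule SUP_upper) simp
      then show ?thesis using B(2) by (intro real_le_rsqrt) (simp add: ennreal_le_iff)
    qed
    then have "summable (\<lambda>n. cmod (d n x))"
      by (intro summableI_nonneg_bounded[of _ "sqrt B"]) (auto simp: h_def)
    then have "summable (\<lambda>n. d n x)" by (rule summable_norm_cancel)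
    then have "convergent (\<lambda>n. \<Sum>k<n. d k x)" by (simp add: summable_iff_convergent)
    then have "convergent (\<lambda>n. (\<Sum>k<n. d k x) + f 0 x)" by (intro convergent_add convergent_const)
    moreover have "(\<Sum>k<n. d k x) + f 0 x = f n x" for n
      unfolding d_def using sum_lessThan_telescope[of "\<lambda>k. f k x" n] by simp
    ultimately show "convergent (\<lambda>n. f n x)" by simp
  qed
  define g where "g x = lim (\<lambda>n. f n x)" for x
  have [measurable]: "g \<in> borel_measurable M"
    unfolding g_def by (rule borel_measurable_lim_metric) simp
  have tail: "norm_L2 M (\<lambda>x. f (n + k) x - f n x) \<le> 2 * (1/2) ^ n - 2 * (1/2) ^ (n + k)" for n k
  proof (induction k)
    case 0
    then show ?case by (simp add: norm_L2_def)
  next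
    case (Suc k)
    then show ?case
      using norm_L2_triangle_diff[OF f[of "n + Suc k"] f[of "n + k"] f[of n]] fast[of "n + k"] by simp
  qed
  have bound: "(\<integral>\<^sup>+x. ennreal ((cmod (g x - f n x))\<^sup>2) \<partial>M) \<le> ennreal ((2 * (1/2) ^ n)\<^sup>2)" for n
  proof -
    have "(\<integral>\<^sup>+x. ennreal ((cmod (g x - f n x))\<^sup>2) \<partial>M)
        \<le> (\<integral>\<^sup>+x. liminf (\<lambda>k. ennreal ((cmod (f (n + k) x - f n x))\<^sup>2)) \<partial>M)"
    proof (rule nn_integral_mono_AE)
      show "AE x in M. ennreal ((cmod (g x - f n x))\<^sup>2)
          \<le> liminf (\<lambda>k. ennreal ((cmod (f (n + k) x - f n x))\<^sup>2))"
        using conv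
      proof eventually_elim
        fix x assume "convergent (\<lambda>n. f n x)"
        then have "(\<lambda>n. f n x) \<longlonglongrightarrow> g x" by (simp add: g_def convergent_LIMSEQ_iff)
        then have "(\<lambda>k. f (n + k) x) \<longlonglongrightarrow> g x"
          using LIMSEQ_ignore_initial_segment[of "\<lambda>n. f n x" "g x" n] by (simp add: add.commute)
        then have "(\<lambda>k. ennreal ((cmod (f (n + k) x - f n x))\<^sup>2)) \<longlonglongrightarrow> ennreal ((cmod (g x - f n x))\<^sup>2)"
          by (intro tendsto_ennrealI tendsto_intros)
        then show "ennreal ((cmod (g x - f n x))\<^sup>2)
          \<le> liminf (\<lambda>k. ennreal ((cmod (f (n + k) x - f n x))\<^sup>2))"
          by (simp add: lim_imp_Liminf del: tendsto_ennreal_iff)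
      qed
    qed
    also have "\<dots> \<le> liminf (\<lambda>k. \<integral>\<^sup>+x. ennreal ((cmod (f (n + k) x - f n x))\<^sup>2) \<partial>M)"
      by (rule nn_integral_liminf) measurable
    also have "\<dots> \<le> liminf (\<lambda>k::nat. ennreal ((2 * (1/2) ^ n)\<^sup>2))"
    proof (intro Liminf_mono always_eventually allI)
      fix k
      have "0 \<le> 2 * (1/2::real) ^ (n + k)" by simp
      then have "norm_L2 M (\<lambda>x. f (n + k) x - f n x) \<le> 2 * (1/2) ^ n" using tail[of n k] by linarith
      then show "(\<integral>\<^sup>+x. ennreal ((cmod (f (n + k) x - f n x))\<^sup>2) \<partial>M) \<le> ennreal ((2 * (1/2) ^ n)\<^sup>2)"
        unfolding nn_integral_norm_L2[OF L2_diff[OF f f]] by (intro ennreal_leI power_mono) auto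
    qed
    also have "\<dots> = ennreal ((2 * (1/2) ^ n)\<^sup>2)" by (simp add: Liminf_const)
    finally show ?thesis .
  qed
  have gf: "(\<lambda>x. g x - f n x) \<in> L2 M" "norm_L2 M (\<lambda>x. g x - f n x) \<le> 2 * (1/2) ^ n" for n
    using L2I_nn_integral[OF _ bound[of n]] by auto
  show ?thesis
  proof
    show "g \<in> L2 M" using L2_add[OF gf(1) f, of 0 0] by simp
    have "(\<lambda>n. 2 * (1/2::real) ^ n) \<longlonglongrightarrow> 2 * 0"
      by (intro tendsto_intros LIMSEQ_realpow_zero) auto
    then have lim: "(\<lambda>n. 2 * (1/2::real) ^ n) \<longlonglongrightarrow> 0" by simp
    show "(\<lambda>n. norm_L2 M (\<lambda>x. g x - f n x)) \<longlonglongrightarrow> 0"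
      by (rule real_tendsto_sandwich[OF _ _ tendsto_const lim])
         (intro always_eventually allI norm_L2_nonneg gf(2))+
  qed
qed

text \<open>
  The partial sums run over an increasing sequence of finite sets that
  exhaust the supremum of \<open>\<Sum> |c\<^sub>k|\<^sup>2\<close> geometrically; an index that never enters these sets
  must have \<open>c\<^sub>k = 0\<close>.
\<close>

lemma Riesz_Fischer:
  assumes b: "orthonormal_family M K b"
    and bounded: "\<And>F. finite F \<Longrightarrow> F \<subseteq> K \<Longrightarrow> (\<Sum>k\<in>F. (cmod (c k))\<^sup>2) \<le> C"
  obtains g where "g \<in> closed_span M (b ` K)" "\<And>k. k \<in> K \<Longrightarrow> inner_L2 M g (b k) = c k"
proof -
  define X where "X = (\<lambda>F. \<Sum>k\<in>F. (cmod (c k))\<^sup>2) ` {F. finite F \<and> F \<subseteq> K}"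
  have X: "X \<noteq> {}" "bdd_above X" using bounded by (auto simp: X_def bdd_above_def)
  have "\<exists>F. finite F \<and> F \<subseteq> K \<and> Sup X - (1/4)^n < (\<Sum>k\<in>F. (cmod (c k))\<^sup>2)" for n :: nat
  proof -
    have "Sup X - (1/4)^n < Sup X" by simp
    then obtain y where "y \<in> X" "Sup X - (1/4)^n < y"
      using less_cSup_iff[OF X] by blast
    then show ?thesis by (auto simp: X_def)
  qed
  then obtain F where F: "\<And>n. finite (F n)" "\<And>n. F n \<subseteq> K"
      "\<And>n. Sup X - (1/4)^n < (\<Sum>k\<in>F n. (cmod (c k))\<^sup>2)" by metis
  define E where "E n = (\<Union>i\<le>n. F i)" for n
  have E: "finite (E n)" "E n \<subseteq> K" "F n \<subseteq> E n" "E n \<subseteq> E (Suc n)" for n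
    using F(1,2) by (auto simp: E_def intro: le_SucI)
  \<comment> \<open>Any finite set disjoint from \<open>E n\<close> carries at most the defect \<open>(1/4)^n\<close>, which is the square
    of the bound \<open>(1/2)^n\<close> required for completeness.\<close>
  have small: "(\<Sum>k\<in>G. (cmod (c k))\<^sup>2) \<le> (1/4)^n"
    if G: "finite G" "G \<subseteq> K" "G \<inter> E n = {}" for G n
  proof -
    have "F n \<union> G \<in> {F. finite F \<and> F \<subseteq> K}" using F G by auto
    then have "(\<Sum>k\<in>F n \<union> G. (cmod (c k))\<^sup>2) \<le> Sup X"
      using X by (intro cSup_upper) (auto simp: X_def)
    moreover have "(\<Sum>k\<in>F n \<union> G. (cmod (c k))\<^sup>2) = (\<Sum>k\<in>F n. (cmod (c k))\<^sup>2) + (\<Sum>k\<in>G. (cmod (c k))\<^sup>2)"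
      using F(1) G E(3)[of n] by (intro sum.union_disjoint) auto
    ultimately show ?thesis using F(3)[of n] by linarith
  qed
  define s where "s n x = (\<Sum>k\<in>E n. c k * b k x)" for n x
  have sL: "s n \<in> L2 M" for n unfolding s_def by (rule orthonormal_comb_L2[OF b E(2)])
  have "norm_L2 M (\<lambda>x. s (Suc n) x - s n x) \<le> (1/2)^n" for n
  proof (rule power2_le_imp_le)
    have "s (Suc n) x - s n x = (\<Sum>k\<in>E (Suc n) - E n. c k * b k x)" for x
      unfolding s_def using E by (simp add: sum_diff)
    then have "(norm_L2 M (\<lambda>x. s (Suc n) x - s n x))\<^sup>2 = (\<Sum>k\<in>E (Suc n) - E n. (cmod (c k))\<^sup>2)"
      using orthonormal_comb_norm[OF b, of "E (Suc n) - E n" c] E(1) E(2)[of "Suc n"] by (simp add: Diff_subset subset_trans Diff_subset_conv le_supI2)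
    also have "\<dots> \<le> (1/4)^n" by (rule small) (use E in auto)
    also have "\<dots> = ((1/2)^n)\<^sup>2" by (simp add: power2_eq_square flip: power_mult_distrib)
    finally show "(norm_L2 M (\<lambda>x. s (Suc n) x - s n x))\<^sup>2 \<le> ((1/2)^n)\<^sup>2" .
  qed simp
  then obtain g where g: "g \<in> L2 M" "(\<lambda>n. norm_L2 M (\<lambda>x. g x - s n x)) \<longlonglongrightarrow> 0"
    using L2_complete[of s M] sL by blast
  show ?thesis
  proof
    show "g \<in> closed_span M (b ` K)"
      by (rule closed_span_lim[OF orthonormal_familyD(2)[OF b] g(1) _ g(2)])
         (simp add: s_def orthonormal_comb_span[OF E(2)])
    fix k assume k: "k \<in> K"
    have inn: "inner_L2 M (s n) (b k) = (if k \<in> E n then c k else 0)" for n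
      unfolding s_def by (rule orthonormal_comb_inner[OF b E(1,2) k])
    have "\<forall>\<^sub>F n in sequentially. inner_L2 M (s n) (b k) = c k"
    proof (cases "\<exists>n. k \<in> E n")
      case True
      then obtain n where n: "k \<in> E n" by blast
      have "k \<in> E m" if "m \<ge> n" for m
        using n lift_Suc_mono_le[of E, OF E(4) that] by blast
      then show ?thesis unfolding eventually_sequentially inn by auto
    next
      case False
      then have "(cmod (c k))\<^sup>2 \<le> (1/4)^n" for n using small[of "{k}" n] k by simp
      moreover have "(\<lambda>n. (1/4::real)^n) \<longlonglongrightarrow> 0" by (rule LIMSEQ_realpow_zero) auto
      ultimately have "(cmod (c k))\<^sup>2 \<le> 0"
        by (meson LIMSEQ_le_const)
      then show ?thesis unfolding inn by simp
    qed
    then have "(\<lambda>n. inner_L2 M (s n) (b k)) \<longlonglongrightarrow> c k" by (rule tendsto_eventually)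
    moreover have "(\<lambda>n. inner_L2 M (s n) (b k)) \<longlonglongrightarrow> inner_L2 M g (b k)"
      by (rule tendsto_inner_L2[OF sL g(1) orthonormal_familyD(1)[OF b k] g(2)])
    ultimately show "inner_L2 M g (b k) = c k" by (rule LIMSEQ_unique[symmetric])
  qed
qed

lemma L2_counting_iff: "f \<in> L2 counting \<longleftrightarrow> summable (\<lambda>j. (cmod (f j))\<^sup>2)"
  by (simp add: L2_iff integrable_count_space_nat_iff)

lemma norm_L2_counting_zero:
  assumes "f \<in> L2 counting" "norm_L2 counting f = 0"
  shows "f j = 0"
proof -
  have "(\<integral>x. (cmod (f x))\<^sup>2 \<partial>counting) = 0"
    using assms(2) by (simp add: norm_L2_def)
  then have "AE x in counting. (cmod (f x))\<^sup>2 = 0"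
    using assms(1) by (subst (asm) integral_nonneg_eq_0_iff_AE) (auto simp: L2_iff)
  then show ?thesis by (simp add: AE_count_space)
qed

lemma fourier_coeffs_L2:
  assumes "orthonormal_family M (UNIV :: nat set) b" "h \<in> L2 M"
  shows "(\<lambda>j. inner_L2 M h (b j)) \<in> L2 counting"
  unfolding L2_counting_iff
  by (rule summableI_nonneg_bounded[where x = "(norm_L2 M h)\<^sup>2"])
     (use Bessel_inequality[OF assms(1) _ _ assms(2)] in auto)

lemma Parseval:
  assumes b: "orthonormal_family M (UNIV :: nat set) b"
    and f: "f \<in> closed_span M (range b)" and g: "g \<in> L2 M"
  shows "inner_L2 counting (\<lambda>j. inner_L2 M f (b j)) (\<lambda>j. inner_L2 M g (b j)) = inner_L2 M f g"
proof -
  have fL: "f \<in> L2 M" using f closed_span_L2 by blast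
  define s where "s n x = (\<Sum>j<n. inner_L2 M f (b j) * b j x)" for n x
  have sL: "s n \<in> L2 M" for n unfolding s_def by (rule orthonormal_comb_L2[OF b]) simp
  have "(\<lambda>n. norm_L2 M (\<lambda>x. f x - s n x)) \<longlonglongrightarrow> 0"
  proof (rule LIMSEQ_I)
    fix e :: real assume "0 < e"
    from closed_span_orthonormal_approx[OF b f this]
    obtain F where F: "finite F \<and> F \<subseteq> UNIV \<and> (\<forall>G. finite G \<longrightarrow> F \<subseteq> G \<longrightarrow> G \<subseteq> UNIV \<longrightarrow>
        norm_L2 M (\<lambda>x. f x - (\<Sum>k\<in>G. inner_L2 M f (b k) * b k x)) < e)"
      by (rule exE) (rule that)
    obtain N where "F \<subseteq> {..<N}" using conjunct1[OF F] finite_nat_iff_bounded by auto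
    then have "norm_L2 M (\<lambda>x. f x - s n x) < e" if "n \<ge> N" for n
      unfolding s_def using that by (intro F[THEN conjunct2, THEN conjunct2, rule_format]) auto
    then show "\<exists>no. \<forall>n\<ge>no. norm (norm_L2 M (\<lambda>x. f x - s n x) - 0) < e" by auto
  qed
  then have "(\<lambda>n. inner_L2 M (s n) g) \<longlonglongrightarrow> inner_L2 M f g"
    by (intro tendsto_inner_L2 sL fL g)
  moreover have "inner_L2 M (s n) g = (\<Sum>j<n. inner_L2 M f (b j) * cnj (inner_L2 M g (b j)))" for n
  proof -
    have "inner_L2 M (s n) g = (\<Sum>j<n. inner_L2 M f (b j) * inner_L2 M (b j) g)"
      unfolding s_def by (rule inner_L2_comb_left) (use g orthonormal_familyD[OF b] in auto)
    then show ?thesis by (simp add: inner_L2_cnj[of M _ g])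
  qed
  ultimately have "(\<lambda>j. inner_L2 M f (b j) * cnj (inner_L2 M g (b j))) sums inner_L2 M f g"
    by (simp add: sums_def)
  moreover have "(\<lambda>j. inner_L2 M f (b j) * cnj (inner_L2 M g (b j))) sums
      inner_L2 counting (\<lambda>j. inner_L2 M f (b j)) (\<lambda>j. inner_L2 M g (b j))"
    unfolding inner_L2_def[of counting]
    by (rule sums_integral_count_space_nat) (rule integrable_mult_cnj[OF fourier_coeffs_L2[OF b fL] fourier_coeffs_L2[OF b g]])
  ultimately show ?thesis by (rule sums_unique2[symmetric])
qed

section \<open>The operator between two orthonormal systems\<close>

text \<open>
  One half of Parseval's identity for an arbitrary index set: on the closed span the norm is
  controlled by the coefficients, because the partial sums approximate.
\<close>

lemma closed_span_coeffs_norm_le: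
  assumes b: "orthonormal_family M K b" and g: "g \<in> closed_span M (b ` K)"
    and bound: "\<And>F. finite F \<Longrightarrow> F \<subseteq> K \<Longrightarrow> (\<Sum>k\<in>F. (cmod (inner_L2 M g (b k)))\<^sup>2) \<le> C\<^sup>2"
    and C: "0 \<le> C"
  shows "norm_L2 M g \<le> C"
proof (rule field_le_epsilon)
  fix e :: real assume "0 < e"
  from closed_span_orthonormal_approx[OF b g this]
  obtain F where FG: "finite F \<and> F \<subseteq> K \<and> (\<forall>G. finite G \<longrightarrow> F \<subseteq> G \<longrightarrow> G \<subseteq> K \<longrightarrow>
      norm_L2 M (\<lambda>x. g x - (\<Sum>k\<in>G. inner_L2 M g (b k) * b k x)) < e)"
    by (rule exE) (rule that)
  then have F: "finite F" "F \<subseteq> K"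
    and near: "norm_L2 M (\<lambda>x. g x - (\<Sum>k\<in>F. inner_L2 M g (b k) * b k x)) < e" by simp_all
  let ?s = "\<lambda>x. \<Sum>k\<in>F. inner_L2 M g (b k) * b k x"
  have s: "?s \<in> L2 M" using b F(2) by (rule orthonormal_comb_L2)
  have gL: "g \<in> L2 M" using g closed_span_L2 by blast
  have "(norm_L2 M ?s)\<^sup>2 \<le> C\<^sup>2" unfolding orthonormal_comb_norm[OF b F(1,2)] by (rule bound[OF F(1,2)])
  then have "norm_L2 M ?s \<le> C" using C by (rule power2_le_imp_le)
  moreover have "norm_L2 M g \<le> norm_L2 M (\<lambda>x. g x - ?s x) + norm_L2 M ?s"
    using norm_L2_triangle[OF L2_diff[OF gL s] s] by simp
  ultimately show "norm_L2 M g \<le> C + e" using near by linarith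
qed

lemma bounded_linear_opD:
  assumes "bounded_linear_op M S S' T"
  shows "f \<in> S \<Longrightarrow> T f \<in> S'"
    and "f \<in> S \<Longrightarrow> g \<in> S \<Longrightarrow> T (\<lambda>x. f x + g x) = (\<lambda>x. T f x + T g x)"
    and "f \<in> S \<Longrightarrow> T (\<lambda>x. c * f x) = (\<lambda>x. c * T f x)"
    and "\<exists>C. \<forall>f\<in>S. norm_L2 M (T f) \<le> C * norm_L2 M f"
  using assms by (simp_all add: bounded_linear_op_def)

text \<open>
  A bounded operator is determined by its values on a generating set. The conclusion is equality, not
  just equality up to null sets, because in \<open>\<ell>\<^sup>2\<close> a vector of norm zero is zero.
\<close>

lemma bounded_linear_op_unique:
  fixes T T' :: "(nat \<Rightarrow> complex) \<Rightarrow> (nat \<Rightarrow> complex)"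
  assumes S: "S \<subseteq> L2 counting"
    and T: "bounded_linear_op counting (closed_span counting S) R T" "T \<in> extensional (closed_span counting S)"
    and T': "bounded_linear_op counting (closed_span counting S) R T'" "T' \<in> extensional (closed_span counting S)"
    and R: "R \<subseteq> L2 counting" and eq: "\<And>s. s \<in> S \<Longrightarrow> T s = T' s"
  shows "T = T'"
proof (rule extensionalityI[OF T(2) T'(2)])
  note sub = complex_span_subset_closed_span[OF S]
  have span: "T h = T' h" if h: "h \<in> complex_span S" for h
  proof -
    obtain F c where F: "finite F" "F \<subseteq> S" "h = (\<lambda>x. \<Sum>f\<in>F. c f * f x)"
      using h unfolding complex_span_def by blast
    have "T (\<lambda>x. \<Sum>f\<in>F. c f * f x) = T' (\<lambda>x. \<Sum>f\<in>F. c f * f x)"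
      using F(1,2)
    proof (induction F)
      case empty
      have "U (\<lambda>x. 0) = (\<lambda>x. 0)" if "bounded_linear_op counting (closed_span counting S) R U" for U
        using bounded_linear_opD(3)[OF that subsetD[OF sub complex_span_zero], of 0] by simp
      then show ?case using T T' by simp
    next
      case (insert f F)
      have f: "f \<in> closed_span counting S" "f \<in> S"
        using insert sub complex_span_base by auto
      have "(\<lambda>x. \<Sum>f\<in>F. c f * f x) \<in> complex_span S"
        using insert by (intro complex_span_sum complex_span_base) auto
      then have s: "(\<lambda>x. \<Sum>f\<in>F. c f * f x) \<in> closed_span counting S" using sub by blast
      have cf: "(\<lambda>x. c f * f x) \<in> closed_span counting S" using f(1) by (rule closed_span_scale)
      have "U (\<lambda>x. c f * f x + (\<Sum>f\<in>F. c f * f x)) = (\<lambda>x. c f * U f x + U (\<lambda>x. \<Sum>f\<in>F. c f * f x) x)"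
        if "bounded_linear_op counting (closed_span counting S) R U" for U
        using bounded_linear_opD(2)[OF that cf s] bounded_linear_opD(3)[OF that f(1), of "c f"] by simp
      from this[OF T(1)] this[OF T'(1)] show ?case
        using insert eq[OF f(2)] by simp
    qed
    then show ?thesis by (simp add: F(3))
  qed
  have approx: "\<exists>C\<ge>0. \<forall>f\<in>closed_span counting S. \<forall>h\<in>closed_span counting S.
      norm_L2 counting (\<lambda>x. U f x - U h x) \<le> C * norm_L2 counting (\<lambda>x. f x - h x)"
    if U: "bounded_linear_op counting (closed_span counting S) R U" for U
  proof -
    obtain C where C: "\<And>f. f \<in> closed_span counting S \<Longrightarrow> norm_L2 counting (U f) \<le> C * norm_L2 counting f"
      using bounded_linear_opD(4)[OF U] by blast
    have "norm_L2 counting (\<lambda>x. U f x - U h x) \<le> \<bar>C\<bar> * norm_L2 counting (\<lambda>x. f x - h x)"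
      if f: "f \<in> closed_span counting S" and h: "h \<in> closed_span counting S" for f h
    proof -
      have h': "(\<lambda>x. (-1) * h x) \<in> closed_span counting S" using h by (rule closed_span_scale)
      have "U (\<lambda>x. f x + (-1) * h x) = (\<lambda>x. U f x + (-1) * U h x)"
        using bounded_linear_opD(2)[OF U f h'] bounded_linear_opD(3)[OF U h, of "-1"] by simp
      then have "norm_L2 counting (\<lambda>x. U f x - U h x) \<le> C * norm_L2 counting (\<lambda>x. f x - h x)"
        using C[OF closed_span_add[OF S f h']] by simp
      also have "\<dots> \<le> \<bar>C\<bar> * norm_L2 counting (\<lambda>x. f x - h x)" by (intro mult_right_mono) auto
      finally show ?thesis .
    qed
    then show ?thesis by (intro exI[of _ "\<bar>C\<bar>"]) auto
  qed
  fix f assume f: "f \<in> closed_span counting S"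
  obtain C C' where C: "C \<ge> 0" "C' \<ge> 0"
    "\<And>f h. f \<in> closed_span counting S \<Longrightarrow> h \<in> closed_span counting S \<Longrightarrow>
      norm_L2 counting (\<lambda>x. T f x - T h x) \<le> C * norm_L2 counting (\<lambda>x. f x - h x)"
    "\<And>f h. f \<in> closed_span counting S \<Longrightarrow> h \<in> closed_span counting S \<Longrightarrow>
      norm_L2 counting (\<lambda>x. T' f x - T' h x) \<le> C' * norm_L2 counting (\<lambda>x. f x - h x)"
    using approx[OF T(1)] approx[OF T'(1)] by blast
  have inR: "T h \<in> L2 counting" "T' h \<in> L2 counting" if "h \<in> closed_span counting S" for h
    using bounded_linear_opD(1)[OF T(1) that] bounded_linear_opD(1)[OF T'(1) that] R by auto
  have "norm_L2 counting (\<lambda>x. T f x - T' f x) \<le> 0"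
  proof (rule field_le_epsilon)
    fix e :: real assume e: "0 < e"
    define d where "d = e / (C + C' + 1)"
    have d: "0 < d" "(C + C') * d \<le> e" using C e by (auto simp: d_def field_simps)
    obtain h where h: "h \<in> complex_span S" "norm_L2 counting (\<lambda>x. f x - h x) < d"
      using closed_spanD[OF f d(1)] by blast
    have hc: "h \<in> closed_span counting S" using h sub by blast
    have "norm_L2 counting (\<lambda>x. T f x - T' f x)
        \<le> norm_L2 counting (\<lambda>x. T f x - T h x) + norm_L2 counting (\<lambda>x. T h x - T' f x)"
      by (rule norm_L2_triangle_diff) (use inR f hc in auto)
    also have "norm_L2 counting (\<lambda>x. T h x - T' f x) = norm_L2 counting (\<lambda>x. T' f x - T' h x)"
      unfolding span[OF h(1)] by (rule norm_L2_minus_commute)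
    also have "norm_L2 counting (\<lambda>x. T f x - T h x) + norm_L2 counting (\<lambda>x. T' f x - T' h x)
        \<le> (C + C') * norm_L2 counting (\<lambda>x. f x - h x)"
      using C(3,4)[OF f hc] by (simp add: distrib_right)
    also have "\<dots> \<le> (C + C') * d" using h(2) C by (intro mult_left_mono) auto
    finally show "norm_L2 counting (\<lambda>x. T f x - T' f x) \<le> 0 + e" using d(2) by linarith
  qed
  then have "norm_L2 counting (\<lambda>x. T f x - T' f x) = 0" by (simp add: antisym)
  then show "T f = T' f"
    using norm_L2_counting_zero[OF L2_diff[OF inR[OF f]]] by (intro ext) (simp add: right_minus_eq)
qed

text \<open>
  The operator sends \<open>f\<close> to the vector with the same coefficients in the second system. That vector
  exists by Bessel's inequality for the first system and the Riesz--Fischer theorem for the second, and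
  it is unique because a vector of the closed span that is orthogonal to the system vanishes.
\<close>

lemma orthonormal_transfer_op_exists:
  fixes a b :: "'k \<Rightarrow> nat \<Rightarrow> complex"
  assumes a: "orthonormal_family counting K a" and b: "orthonormal_family counting K b"
  obtains T where "T \<in> extensional (closed_span counting (a ` K))"
    "bounded_linear_op counting (closed_span counting (a ` K)) (closed_span counting (b ` K)) T"
    "\<And>k. k \<in> K \<Longrightarrow> T (a k) = b k"
proof -
  let ?A = "closed_span counting (a ` K)" and ?B = "closed_span counting (b ` K)"
  define R where "R f g \<longleftrightarrow> g \<in> ?B \<and> (\<forall>k\<in>K. inner_L2 counting g (b k) = inner_L2 counting f (a k))" for f g
  have A: "f \<in> L2 counting" if "f \<in> ?A" for f using that closed_span_L2 by blast
  have B: "f \<in> L2 counting" if "f \<in> ?B" for f using that closed_span_L2 by blast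
  note aK = orthonormal_familyD(1)[OF a] and bK = orthonormal_familyD(1)[OF b]
  have unique: "g = g'" if "R f g" "R f g'" for f g g'
  proof -
    have g: "g \<in> ?B" "g' \<in> ?B" using that by (auto simp: R_def)
    have d: "(\<lambda>x. g x + (-1) * g' x) \<in> ?B"
      by (rule closed_span_add[OF orthonormal_familyD(2)[OF b] g(1) closed_span_scale[OF g(2)]])
    have "inner_L2 counting s (\<lambda>x. g x + (-1) * g' x) = 0" if s: "s \<in> b ` K" for s
    proof -
      obtain k where k: "k \<in> K" "s = b k" using s by blast
      have "inner_L2 counting (\<lambda>x. g x - g' x) (b k) = 0"
        using \<open>R f g\<close> \<open>R f g'\<close> k B[OF g(1)] B[OF g(2)] bK
        by (subst inner_L2_diff_left) (auto simp: R_def)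
      then show ?thesis unfolding k(2) by (subst inner_L2_cnj) simp
    qed
    from closed_span_orthogonal[OF orthonormal_familyD(2)[OF b] B[OF d] this d]
    have "norm_L2 counting (\<lambda>x. g x - g' x) = 0" by (simp add: inner_L2_self)
    then show ?thesis
      using norm_L2_counting_zero[OF L2_diff[OF B[OF g(1)] B[OF g(2)]]]
      by (intro ext) (simp add: right_minus_eq)
  qed
  have exists: "\<exists>g. R f g" if f: "f \<in> ?A" for f
  proof -
    obtain g where "g \<in> ?B" "\<And>k. k \<in> K \<Longrightarrow> inner_L2 counting g (b k) = inner_L2 counting f (a k)"
      by (rule Riesz_Fischer[OF b, of "\<lambda>k. inner_L2 counting f (a k)"])
         (use Bessel_inequality[OF a _ _ A[OF f]] in auto)
    then show ?thesis by (auto simp: R_def)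
  qed
  define T where "T = restrict (\<lambda>f. THE g. R f g) ?A"
  have RT: "R f (T f)" if "f \<in> ?A" for f
    using theI'[of "R f"] exists[OF that] unique that by (auto simp: T_def)
  have T_eq: "T f = g" if "f \<in> ?A" "R f g" for f g
    using unique RT that by blast
  show ?thesis
  proof
    show "T \<in> extensional ?A" by (simp add: T_def)
    have add: "T (\<lambda>x. f x + g x) = (\<lambda>x. T f x + T g x)" if f: "f \<in> ?A" and g: "g \<in> ?A" for f g
    proof (rule T_eq)
      show "(\<lambda>x. f x + g x) \<in> ?A" by (rule closed_span_add[OF orthonormal_familyD(2)[OF a] f g])
      have TB: "T f \<in> ?B" "T g \<in> ?B" using RT f g by (auto simp: R_def)
      show "R (\<lambda>x. f x + g x) (\<lambda>x. T f x + T g x)"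
        unfolding R_def
      proof (intro conjI ballI)
        show "(\<lambda>x. T f x + T g x) \<in> ?B"
          by (rule closed_span_add[OF orthonormal_familyD(2)[OF b] TB])
        fix k assume k: "k \<in> K"
        show "inner_L2 counting (\<lambda>x. T f x + T g x) (b k) = inner_L2 counting (\<lambda>x. f x + g x) (a k)"
          using RT[OF f] RT[OF g] k
          by (simp add: inner_L2_add_left A f g B TB aK bK R_def)
      qed
    qed
    have scale: "T (\<lambda>x. c * f x) = (\<lambda>x. c * T f x)" if f: "f \<in> ?A" for f c
    proof (rule T_eq)
      show "(\<lambda>x. c * f x) \<in> ?A" using f by (rule closed_span_scale)
      show "R (\<lambda>x. c * f x) (\<lambda>x. c * T f x)"
        using RT[OF f] unfolding R_def by (simp add: closed_span_scale inner_L2_scale_left)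
    qed
    have bound: "norm_L2 counting (T f) \<le> 1 * norm_L2 counting f" if f: "f \<in> ?A" for f
    proof -
      have "norm_L2 counting (T f) \<le> norm_L2 counting f"
      proof (rule closed_span_coeffs_norm_le[OF b])
        show "T f \<in> ?B" using RT[OF f] by (simp add: R_def)
        fix F assume F: "finite F" "F \<subseteq> K"
        have "(\<Sum>k\<in>F. (cmod (inner_L2 counting (T f) (b k)))\<^sup>2)
            = (\<Sum>k\<in>F. (cmod (inner_L2 counting f (a k)))\<^sup>2)"
          using RT[OF f] F by (intro sum.cong) (auto simp: R_def)
        also have "\<dots> \<le> (norm_L2 counting f)\<^sup>2" by (rule Bessel_inequality[OF a F A[OF f]])
        finally show "(\<Sum>k\<in>F. (cmod (inner_L2 counting (T f) (b k)))\<^sup>2) \<le> (norm_L2 counting f)\<^sup>2" .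
      qed simp
      then show ?thesis by simp
    qed
    show "bounded_linear_op counting ?A ?B T"
      unfolding bounded_linear_op_def
    proof (intro conjI exI[of _ 1])
      show "\<forall>f\<in>?A. T f \<in> ?B" using RT by (auto simp: R_def)
    qed (use add scale bound in blast)+
    fix k assume k: "k \<in> K"
    then show "T (a k) = b k"
      using complex_span_subset_closed_span[OF orthonormal_familyD(2)[OF a]]
        complex_span_subset_closed_span[OF orthonormal_familyD(2)[OF b]] a b
      by (intro T_eq) (auto simp: R_def orthonormal_family_def complex_span_base subset_iff)
  qed
qed

text \<open>
  At a point \<open>w\<close> where both families of fibre vectors are orthonormal, the definite description in
  the definition of the operator is meaningful.
\<close>

lemma fibre_op_characterization:
  assumes a: "orthonormal_family counting K (\<lambda>k. Lvec w (qA k))"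
    and b: "orthonormal_family counting K (\<lambda>k. Lvec w (qC k))"
  shows "fibre_op K qA qC w = T \<longleftrightarrow>
     T \<in> extensional (fibre K qA w) \<and>
     bounded_linear_op counting (fibre K qA w) (fibre K qC w) T \<and>
     (\<forall>k\<in>K. T (Lvec w (qA k)) = Lvec w (qC k))" (is "_ \<longleftrightarrow> ?P T")
proof -
  have "\<exists>T. ?P T"
    using orthonormal_transfer_op_exists[OF a b] unfolding fibre_def by metis
  moreover have "T = T'" if T: "?P T" and T': "?P T'" for T T'
  proof -
    have sub: "fibre K qC w \<subseteq> L2 counting" unfolding fibre_def by (rule closed_span_L2)
    have eq: "T s = T' s" if "s \<in> (\<lambda>k. Lvec w (qA k)) ` K" for s
      using that T T' by auto
    show ?thesis
      by (rule bounded_linear_op_unique[OF orthonormal_familyD(2)[OF a], folded fibre_def,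
          OF T[THEN conjunct2, THEN conjunct1] T[THEN conjunct1]
             T'[THEN conjunct2, THEN conjunct1] T'[THEN conjunct1] sub eq])
  qed
  ultimately have ex1: "\<exists>!T. ?P T" by (rule ex_ex1I)
  show ?thesis unfolding fibre_op_def
  proof
    show "?P T" if "(THE T. ?P T) = T" using theI'[OF ex1] unfolding that .
    show "(THE T. ?P T) = T" if "?P T" using ex1 that by (rule the1_equality[where P = ?P])
  qed
qed

text \<open>
  The composition of two bounded operators is bounded and has the prescribed values on the generators,
  so the uniqueness of the operator between the outer fibres identifies it.
\<close>

lemma fibre_op_compose:
  assumes M: "orthonormal_family counting K (\<lambda>k. Lvec w (qM k))"
    and L: "orthonormal_family counting K (\<lambda>k. Lvec w (qL k))"
    and N: "orthonormal_family counting K (\<lambda>k. Lvec w (qN k))"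
  shows "fibre_op K qM qN w = compose (fibre K qM w) (fibre_op K qL qN w) (fibre_op K qM qL w)"
proof -
  define T where "T = fibre_op K qM qL w"
  define U where "U = fibre_op K qL qN w"
  have T: "bounded_linear_op counting (fibre K qM w) (fibre K qL w) T"
      "\<And>k. k \<in> K \<Longrightarrow> T (Lvec w (qM k)) = Lvec w (qL k)"
    using fibre_op_characterization[OF M L, of T] by (auto simp: T_def)
  have U: "bounded_linear_op counting (fibre K qL w) (fibre K qN w) U"
      "\<And>k. k \<in> K \<Longrightarrow> U (Lvec w (qL k)) = Lvec w (qN k)"
    using fibre_op_characterization[OF L N, of U] by (auto simp: U_def)
  have M_sub: "(\<lambda>k. Lvec w (qM k)) ` K \<subseteq> L2 counting" by (rule orthonormal_familyD(2)[OF M])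
  have inM: "Lvec w (qM k) \<in> fibre K qM w" if "k \<in> K" for k
    unfolding fibre_def
    by (rule subsetD[OF complex_span_subset_closed_span[OF M_sub]])
       (use that in \<open>auto intro: complex_span_base\<close>)
  have TL: "\<And>f. f \<in> fibre K qM w \<Longrightarrow> T f \<in> fibre K qL w"
    by (rule bounded_linear_opD(1)[OF T(1)])
  obtain C D where C: "\<And>f. f \<in> fibre K qM w \<Longrightarrow> norm_L2 counting (T f) \<le> C * norm_L2 counting f"
    and D: "\<And>f. f \<in> fibre K qL w \<Longrightarrow> norm_L2 counting (U f) \<le> D * norm_L2 counting f"
    using bounded_linear_opD(4)[OF T(1)] bounded_linear_opD(4)[OF U(1)] by blast
  have "norm_L2 counting (U (T f)) \<le> (\<bar>D\<bar> * C) * norm_L2 counting f" if f: "f \<in> fibre K qM w" for f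
  proof -
    have "norm_L2 counting (U (T f)) \<le> D * norm_L2 counting (T f)" by (rule D[OF TL[OF f]])
    also have "\<dots> \<le> \<bar>D\<bar> * norm_L2 counting (T f)" by (intro mult_right_mono) auto
    also have "\<dots> \<le> \<bar>D\<bar> * (C * norm_L2 counting f)" by (intro mult_left_mono C f) auto
    finally show ?thesis by (simp add: mult.assoc)
  qed
  moreover have "(\<lambda>x. f x + g x) \<in> fibre K qM w" if "f \<in> fibre K qM w" "g \<in> fibre K qM w" for f g
    using closed_span_add[OF M_sub] that by (simp add: fibre_def)
  moreover have "(\<lambda>x. c * f x) \<in> fibre K qM w" if "f \<in> fibre K qM w" for f c
    using closed_span_scale that by (simp add: fibre_def)
  ultimately have "bounded_linear_op counting (fibre K qM w) (fibre K qN w) (compose (fibre K qM w) U T)"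
    using TL bounded_linear_opD(1)[OF U(1)]
    by (auto simp: bounded_linear_op_def compose_eq bounded_linear_opD(2,3)[OF T(1)]
        bounded_linear_opD(2,3)[OF U(1)])
  moreover have "\<forall>k\<in>K. compose (fibre K qM w) U T (Lvec w (qM k)) = Lvec w (qN k)"
    using T(2) U(2) inM by (simp add: compose_eq)
  moreover have "compose (fibre K qM w) U T \<in> extensional (fibre K qM w)"
    by (rule compose_extensional)
  ultimately show ?thesis
    using fibre_op_characterization[OF M N] unfolding T_def U_def by blast
qed

section \<open>Fourier analysis on the circle\<close>

lemma sets_circle [simp, measurable_cong]: "sets circle = sets borel"
  by (simp add: circle_def)

lemma space_circle [simp]: "space circle = UNIV"
  by (simp add: circle_def)

lemma cis_measurable [measurable]: "cis \<in> borel_measurable borel"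
  by (intro borel_measurable_continuous_onI continuous_on_cis continuous_on_id)

lemma emeasure_circle: "emeasure circle UNIV = 1"
proof -
  have "emeasure lborel {0..2 * pi} = ennreal (2 * pi)" by simp
  then have "emeasure (uniform_measure lborel {0..2 * pi}) {0..2 * pi} = 1"
    by (intro emeasure_uniform_measure_1) (simp_all add: ennreal_eq_0_iff not_le)
  then have "emeasure (uniform_measure lborel {0..2 * pi}) UNIV = 1"
    by simp
  then show ?thesis
    by (simp add: circle_def emeasure_distr)
qed

interpretation circle: finite_measure circle
  by (rule finite_measureI) (simp add: emeasure_circle)

lemma measure_circle [simp]: "measure circle UNIV = 1"
  by (simp add: measure_def emeasure_circle)

lemma AE_circle_norm: "AE z in circle. cmod z = 1"
  unfolding circle_def by (subst AE_distr_iff) auto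

lemma AE_circle_nonzero: "AE z in circle. z \<noteq> 0"
  using AE_circle_norm by eventually_elim auto

lemma borel_measurable_power_int [measurable (raw)]:
  fixes f :: "'a \<Rightarrow> complex"
  shows "f \<in> borel_measurable M \<Longrightarrow> (\<lambda>x. f x powi n) \<in> borel_measurable M"
  by (cases "0 \<le> n") (auto simp: power_int_def intro: borel_measurable_power borel_measurable_inverse)

lemma integral_circle:
  assumes [measurable]: "f \<in> borel_measurable borel"
  shows "(\<integral>z. f z \<partial>circle) = (\<integral>t. indicator {0..2*pi} t *\<^sub>R (f (cis t) :: complex) \<partial>lborel) / (2 * pi)"
proof -
  have e: "indicator {0..2 * pi} t / emeasure lborel {0..2*pi} = ennreal (indicator {0..2 * pi} t / (2 * pi))" for t
    by (auto simp: divide_ennreal indicator_def zero_ennreal.rep_eq simp flip: ennreal_1)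
  have "(\<integral>z. f z \<partial>circle) = (\<integral>t. f (cis t) \<partial>uniform_measure lborel {0..2 * pi})"
    unfolding circle_def by (rule integral_distr) measurable
  also have "\<dots> = (\<integral>t. (indicator {0..2 * pi} t / (2 * pi)) *\<^sub>R f (cis t) \<partial>lborel)"
    unfolding uniform_measure_def e by (rule integral_density) (auto simp: indicator_def)
  also have "\<dots> = (\<integral>t. (indicator {0..2*pi} t *\<^sub>R f (cis t)) / (2 * pi) \<partial>lborel)"
    by (intro Bochner_Integration.integral_cong) (auto simp: scaleR_conv_of_real)
  finally show ?thesis by simp
qed

text \<open>
  Orthogonality of characters, by integrating \<open>cis (n t)\<close> over a period.
\<close>

lemma integral_circle_power_int: "(\<integral>z. z powi n \<partial>circle) = (if n = 0 then 1 else 0)"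
proof (cases "n = 0")
  case True
  then show ?thesis by simp
next
  case False
  let ?F = "\<lambda>t. cis (of_int n * t) / (\<i> * of_int n)"
  have "(\<integral>z. z powi n \<partial>circle) = (\<integral>t. indicator {0..2*pi} t *\<^sub>R cis (of_int n * t) \<partial>lborel) / (2 * pi)"
    by (subst integral_circle) (simp_all add: cis_power_int)
  also have "(\<integral>t. indicator {0..2*pi} t *\<^sub>R cis (of_int n * t) \<partial>lborel) = ?F (2 * pi) - ?F 0"
  proof (rule integral_FTC_atLeastAtMost)
    fix t :: real
    show "(?F has_vector_derivative cis (of_int n * t)) (at t within {0..2 * pi})"
      unfolding has_vector_derivative_def
      by (rule derivative_eq_intros refl | simp)+ (use False in \<open>auto simp: scaleR_conv_of_real field_simps\<close>)
    show "continuous_on {0..2 * pi} (\<lambda>t. cis (of_int n * t))" by (intro continuous_intros)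
  qed simp
  also have "?F (2 * pi) = ?F 0"
    using cis_multiple_2pi[of "of_int n"] by (simp add: mult.commute)
  finally show ?thesis using False by simp
qed

lemma integrable_circle_mult_power_int:
  assumes "integrable circle f"
  shows "integrable circle (\<lambda>z. f z * z powi n)"
proof (rule Bochner_Integration.integrable_bound[OF assms])
  have [measurable]: "f \<in> borel_measurable borel" using assms by (auto dest: borel_measurable_integrable)
  show "(\<lambda>z. f z * z powi n) \<in> borel_measurable circle" by measurable
  show "AE z in circle. norm (f z * z powi n) \<le> norm (f z)"
    using AE_circle_norm by eventually_elim (simp add: norm_mult norm_power_int)
qed

text \<open>
  The functions all of whose Fourier coefficients vanish form a module over the polynomials in the real
  and imaginary parts of \<open>z\<close>: on the circle, multiplication by \<open>z\<close> or by \<open>cnj z = z powi (-1)\<close>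
  only shifts the coefficients. Quantifying over \<open>f\<close> makes the step for products of polynomials
  immediate.
\<close>

lemma null_fourier_mult_polynomial:
  fixes p :: "complex \<Rightarrow> real"
  assumes "real_polynomial_function p" "integrable circle f" "\<And>m. (\<integral>z. f z * z powi m \<partial>circle) = 0"
  shows "integrable circle (\<lambda>z. f z * of_real (p z)) \<and> (\<forall>m. (\<integral>z. f z * of_real (p z) * z powi m \<partial>circle) = 0)"
  using assms
proof (induction p arbitrary: f rule: real_polynomial_function.induct)
  case (linear p)
  \<comment> \<open>A real linear form on the plane is \<open>a z + b (cnj z)\<close> with these coefficients.\<close>
  define a b where "a = (of_real (p 1) - \<i> * of_real (p \<i>)) / 2" and "b = (of_real (p 1) + \<i> * of_real (p \<i>)) / 2"
  note int = integrable_circle_mult_power_int[OF linear(2)]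
  have p: "complex_of_real (p z) = a * z + b * cnj z" for z
  proof -
    interpret bounded_linear p by fact
    have "z = Re z *\<^sub>R 1 + Im z *\<^sub>R \<i>" by (simp add: complex_eq_iff)
    then have "p z = Re z * p 1 + Im z * p \<i>" using add scaleR by (metis real_scaleR_def)
    then show ?thesis by (simp add: a_def b_def complex_eq_iff field_simps)
  qed
  have [measurable]: "f \<in> borel_measurable borel" using linear by (auto dest: borel_measurable_integrable)
  have [measurable]: "p \<in> borel_measurable borel"
    by (intro borel_measurable_continuous_onI linear_continuous_on linear(1))
  have eq: "AE z in circle. f z * of_real (p z) * z powi m = a * (f z * z powi (m + 1)) + b * (f z * z powi (m - 1))" for m
    using AE_circle_norm
  proof eventually_elim
    fix z :: complex assume z: "cmod z = 1"
    then have "z \<noteq> 0" by auto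
    moreover from z have "cnj z = inverse z"
      using complex_norm_square[of z] \<open>z \<noteq> 0\<close> by (simp add: field_simps)
    ultimately show "f z * of_real (p z) * z powi m = a * (f z * z powi (m + 1)) + b * (f z * z powi (m - 1))"
      by (simp add: p power_int_add power_int_diff field_simps)
  qed
  have i: "integrable circle (\<lambda>z. f z * of_real (p z) * z powi m)" for m
    by (subst integrable_cong_AE[OF _ _ eq]) (use int in auto)
  have "(\<integral>z. f z * of_real (p z) * z powi m \<partial>circle) = 0" for m
    by (subst integral_cong_AE[OF _ _ eq]) (use int linear(3) in auto)
  then show ?case using i[of 0] by simp
next
  case (const c)
  then show ?case by (simp add: mult.commute[of _ "of_real c"] mult.assoc)
next
  case (add p q)
  from add(3,4)[OF add(5,6)] show ?case
    by (simp add: distrib_left distrib_right integrable_circle_mult_power_int)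
next
  case (mult p q)
  from mult(4)[of "\<lambda>z. f z * of_real (p z)"] mult(3)[OF mult(5,6)] show ?case
    by (simp add: mult.assoc)
qed

text \<open>
  By the Stone--Weierstrass theorem a continuous function is, on the circle, a uniform limit of
  polynomials in the real and imaginary parts.
\<close>

lemma integral_circle_continuous_zero:
  fixes f :: "complex \<Rightarrow> complex" and u :: "complex \<Rightarrow> real"
  assumes f: "integrable circle f" and coeff: "\<And>m. (\<integral>z. f z * z powi m \<partial>circle) = 0"
    and u: "continuous_on UNIV u"
  shows "(\<integral>z. f z * of_real (u z) \<partial>circle) = 0"
proof -
  have [measurable]: "f \<in> borel_measurable borel" using f by (auto dest: borel_measurable_integrable)
  have [measurable]: "u \<in> borel_measurable borel" using u by (rule borel_measurable_continuous_onI)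
  define I where "I = (\<integral>z. cmod (f z) \<partial>circle)"
  have "cmod (\<integral>z. f z * of_real (u z) \<partial>circle) \<le> 0 + e" if "e > 0" for e
  proof -
    have I: "0 \<le> I" unfolding I_def by simp
    \<comment> \<open>An error \<open>d\<close> in \<open>u\<close> changes the integral by at most \<open>I * d\<close>.\<close>
    define d where "d = e / (I + 1)"
    have d: "0 < d" "I * d \<le> e" using that I by (auto simp: d_def field_simps)
    obtain p where p: "real_polynomial_function p" "\<And>z. z \<in> sphere 0 1 \<Longrightarrow> \<bar>u z - p z\<bar> < d"
      using Stone_Weierstrass_real_polynomial_function[of "sphere 0 1" u d] d(1)
        continuous_on_subset[OF u] by auto
    note fp = null_fourier_mult_polynomial[OF p(1) f coeff]
    have fp0: "integrable circle (\<lambda>z. f z * of_real (p z))" "(\<integral>z. f z * of_real (p z) \<partial>circle) = 0"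
      using fp spec[OF conjunct2[OF fp], of 0] by simp_all
    have close: "AE z in circle. norm (f z * of_real (u z) - f z * of_real (p z)) \<le> cmod (f z) * d"
      using AE_circle_norm
    proof eventually_elim
      fix z :: complex assume "cmod z = 1"
      then have "\<bar>u z - p z\<bar> \<le> d" using p(2)[of z] by (simp add: dist_norm)
      then have "cmod (of_real (u z - p z)) \<le> d" by (simp only: norm_of_real)
      then show "norm (f z * of_real (u z) - f z * of_real (p z)) \<le> cmod (f z) * d"
        by (simp add: mult_left_mono norm_mult flip: right_diff_distrib of_real_diff)
    qed
    have [measurable]: "(\<lambda>z. f z * of_real (p z)) \<in> borel_measurable borel"
      using fp0(1) by (auto dest: borel_measurable_integrable)
    have fd: "integrable circle (\<lambda>z. cmod (f z) * d)" using f by simp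
    have diff: "integrable circle (\<lambda>z. f z * of_real (u z) - f z * of_real (p z))"
    proof (rule Bochner_Integration.integrable_bound[OF fd])
      show "AE z in circle. norm (f z * of_real (u z) - f z * of_real (p z)) \<le> norm (cmod (f z) * d)"
        using close by eventually_elim (use d in simp)
    qed measurable
    then have "integrable circle (\<lambda>z. f z * of_real (u z))"
      using Bochner_Integration.integrable_add[OF diff fp0(1)] by simp
    then have "(\<integral>z. f z * of_real (u z) \<partial>circle) = (\<integral>z. f z * of_real (u z) - f z * of_real (p z) \<partial>circle)"
      using fp0 by simp
    also have "cmod \<dots> \<le> (\<integral>z. cmod (f z) * d \<partial>circle)"
      by (rule order_trans[OF integral_norm_bound integral_mono_AE[OF _ fd close]]) (use diff in simp)
    also have "\<dots> \<le> e" using d(2) by (simp add: I_def)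
    finally show ?thesis by simp
  qed
  then have "cmod (\<integral>z. f z * of_real (u z) \<partial>circle) \<le> 0" by (rule field_le_epsilon)
  then show ?thesis by simp
qed

text \<open>
  Uniqueness of Fourier coefficients for integrable functions. The indicator of a closed set is a
  bounded pointwise limit of continuous functions, so the integral of \<open>f\<close> over every closed set
  vanishes; a Dynkin argument extends this to all Borel sets.
\<close>

lemma AE_circle_zeroI:
  assumes f: "integrable circle f" and coeff: "\<And>m. (\<integral>z. f z * z powi m \<partial>circle) = 0"
  shows "AE z in circle. f z = (0 :: complex)"
proof (rule circle.density_zero[OF f])
  have [measurable]: "f \<in> borel_measurable borel" using f by (auto dest: borel_measurable_integrable)
  have int: "set_integrable circle A f" if "A \<in> sets borel" for A
    unfolding set_integrable_def by (rule integrable_mult_indicator) (use f that in auto)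
  have cl: "set_lebesgue_integral circle C f = 0" if C: "closed C" for C
  proof (cases "C = {}")
    case True
    then show ?thesis by (simp add: set_lebesgue_integral_def)
  next
    case False
    \<comment> \<open>Continuous functions decreasing to the indicator of \<open>C\<close>.\<close>
    define u where "u n z = max 0 (1 - real n * infdist z C)" for n z
    have u01: "0 \<le> u n z" "u n z \<le> 1" for n z
      by (auto simp: u_def infdist_nonneg)
    have cu: "continuous_on UNIV (u n)" for n
      unfolding u_def by (intro continuous_intros)
    then have [measurable]: "u n \<in> borel_measurable borel" for n
      by (rule borel_measurable_continuous_onI)
    have [measurable]: "C \<in> sets borel" using C by simp
    have "(\<lambda>n. u n z) \<longlonglongrightarrow> indicator C z" for z
    proof (cases "z \<in> C")
      case True
      then show ?thesis by (simp add: u_def)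
    next
      case zC: False
      then have pos: "infdist z C > 0"
        using in_closed_iff_infdist_zero[OF C False] infdist_nonneg[of z C] by (auto simp: less_le)
      obtain N where N: "1 < real N * infdist z C" using reals_Archimedean3[OF pos] by blast
      have "u n z = 0" if "n \<ge> N" for n
      proof -
        have "real N * infdist z C \<le> real n * infdist z C" using that pos by (intro mult_right_mono) auto
        then show ?thesis using N by (simp add: u_def)
      qed
      then have "\<forall>\<^sub>F n in sequentially. u n z = 0" unfolding eventually_sequentially by blast
      then show ?thesis using zC by (simp add: tendsto_eventually)
    qed
    then have "(\<lambda>n. \<integral>z. f z * of_real (u n z) \<partial>circle) \<longlonglongrightarrow> (\<integral>z. f z * of_real (indicator C z) \<partial>circle)"
    proof (intro integral_dominated_convergence[where w = "\<lambda>z. cmod (f z)"] AE_I2 tendsto_intros)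
      show "norm (f z * of_real (u n z)) \<le> cmod (f z)" for n z
        using u01[of n z] by (simp add: norm_mult mult_left_le)
    qed (use f in auto)
    then have "(\<integral>z. f z * of_real (indicator C z) \<partial>circle) = 0"
      unfolding integral_circle_continuous_zero[OF f coeff cu] by (simp add: LIMSEQ_const_iff)
    then show ?thesis
      by (simp add: set_lebesgue_integral_def scaleR_conv_of_real mult.commute)
  qed
  fix A assume "A \<in> sets circle"
  then have A: "A \<in> sigma_sets UNIV (Collect closed)" by (simp add: borel_eq_closed)
  have "Int_stable (Collect closed :: complex set set)" by (auto intro!: Int_stableI)
  moreover have "Collect closed \<subseteq> Pow (UNIV :: complex set)" by simp
  ultimately show "set_lebesgue_integral circle A f = 0" using A
  proof (induction rule: sigma_sets_induct_disjoint)
    case (basic A)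
    then show ?case using cl by simp
  next
    case empty
    then show ?case by (simp add: set_lebesgue_integral_def)
  next
    case (compl A)
    have A: "A \<in> sets borel" using compl(1) by (simp add: borel_eq_closed)
    have "set_lebesgue_integral circle (A \<union> (UNIV - A)) f
        = set_lebesgue_integral circle A f + set_lebesgue_integral circle (UNIV - A) f"
      by (rule set_integral_Un) (use int A in auto)
    then show ?case using compl(2) cl[of UNIV] by simp
  next
    case (union A)
    have A: "A i \<in> sets borel" for i using union(2) by (auto simp: borel_eq_closed)
    have "set_lebesgue_integral circle (\<Union>i. A i) f = (\<Sum>i. set_lebesgue_integral circle (A i) f)"
    proof (rule lebesgue_integral_countable_add)
      show "A i \<inter> A j = {}" if "i \<noteq> j" for i j
        using union(1) that by (auto simp: disjoint_family_on_def)
    qed (use A int in auto)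
    then show ?case using union(3) by simp
  qed
qed

lemma cnj_power_int_unimodular:
  assumes "cmod z = 1"
  shows "cnj (z powi n) = z powi (- n)"
proof -
  have "z \<noteq> 0" using assms by auto
  then have "cnj z = inverse z" using complex_norm_square[of z] assms by (simp add: field_simps)
  then show ?thesis by (simp add: power_int_minus power_int_inverse)
qed

lemma orthonormal_power_circle: "orthonormal_family circle (UNIV :: nat set) (\<lambda>j z. z ^ j)"
proof -
  have L: "(\<lambda>z. z ^ j) \<in> L2 circle" for j
  proof -
    have "AE z in circle. cmod (z ^ j) = 1"
      using AE_circle_norm by eventually_elim (simp add: norm_power)
    then show ?thesis
      using L2_mult_unimodular[of "\<lambda>_. 1" circle "\<lambda>z. z ^ j"] by (simp add: L2_iff)
  qed
  have "inner_L2 circle (\<lambda>z. z ^ j) (\<lambda>z. z ^ k) = (\<integral>z. z powi (int j - int k) \<partial>circle)" for j k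
    unfolding inner_L2_def
  proof (rule integral_cong_AE)
    show "AE z in circle. z ^ j * cnj (z ^ k) = z powi (int j - int k)"
      using AE_circle_norm
    proof eventually_elim
      fix z :: complex assume z: "cmod z = 1"
      have "z \<noteq> 0" using z by auto
      then show "z ^ j * cnj (z ^ k) = z powi (int j - int k)"
        using cnj_power_int_unimodular[OF z, of "int k"]
        by (simp add: power_int_diff power_int_minus field_simps)
    qed
  qed measurable
  then show ?thesis using L by (auto simp: orthonormal_family_def integral_circle_power_int)
qed

section \<open>Fourier coefficients on the torus\<close>

interpretation torus: pair_sigma_finite circle circle ..

lemma sets_torus [measurable_cong]: "sets torus = sets (circle \<Otimes>\<^sub>M circle)"
  unfolding torus_def ..

lemma space_torus [simp]: "space torus = UNIV"
  by (simp add: torus_def space_pair_measure)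

interpretation torus: finite_measure torus
proof (rule finite_measureI)
  have "emeasure torus (UNIV \<times> UNIV) = 1"
    unfolding torus_def using circle.emeasure_pair_measure_Times[of UNIV circle UNIV]
    by (simp add: emeasure_circle)
  then show "emeasure torus (space torus) \<noteq> \<infinity>" by simp
qed

lemma torus_Fubini:
  fixes F :: "complex \<times> complex \<Rightarrow> 'b :: {banach, second_countable_topology}"
  assumes "integrable torus F"
  shows "(\<integral>w. (\<integral>z. F (z, w) \<partial>circle) \<partial>circle) = (\<integral>x. F x \<partial>torus)"
    and "integrable circle (\<lambda>w. \<integral>z. F (z, w) \<partial>circle)"
    and "AE w in circle. integrable circle (\<lambda>z. F (z, w))"
  using torus.integral_snd[of "\<lambda>z w. F (z, w)"] torus.integrable_snd[of "\<lambda>z w. F (z, w)"]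
    torus.AE_integrable_snd[of "\<lambda>z w. F (z, w)"] assms by (simp_all add: torus_def)

lemma AE_torus_norm: "AE x in torus. cmod (fst x) = 1 \<and> cmod (snd x) = 1"
  unfolding torus_def
proof (rule torus.AE_pair_measure)
  show "AE z in circle. AE w in circle. cmod (fst (z, w)) = 1 \<and> cmod (snd (z, w)) = 1"
    using AE_circle_norm
  proof eventually_elim
    fix z :: complex assume "cmod z = 1"
    with AE_circle_norm show "AE w in circle. cmod (fst (z, w)) = 1 \<and> cmod (snd (z, w)) = 1"
      by simp
  qed
qed measurable

text \<open>
  The exponents are integers: on the torus a negative power is the power of a conjugate, so these are all
  the characters.
\<close>

definition monomial :: "int \<Rightarrow> int \<Rightarrow> complex \<times> complex \<Rightarrow> complex" where
  "monomial i j = (\<lambda>(z, w). z powi i * w powi j)"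

abbreviation fourier :: "(complex \<times> complex \<Rightarrow> complex) \<Rightarrow> int \<Rightarrow> int \<Rightarrow> complex" where
  "fourier f i j \<equiv> inner_L2 torus f (monomial i j)"

lemma monomial_measurable [measurable]: "monomial i j \<in> borel_measurable torus"
  unfolding monomial_def by measurable

lemma monomial_norm: "AE x in torus. cmod (monomial i j x) = 1"
  using AE_torus_norm
  by eventually_elim (simp add: monomial_def norm_mult norm_power_int case_prod_unfold)

lemma monomial_L2: "monomial i j \<in> L2 torus"
  using L2_mult_unimodular[OF _ _ monomial_norm, of "\<lambda>_. 1" i j] by (simp add: L2_iff)

lemma monomial_mult_cnj: "AE x in torus. monomial i j x * cnj (monomial k l x) = monomial (i - k) (j - l) x"
  using AE_torus_norm
proof eventually_elim
  fix x :: "complex \<times> complex" assume x: "cmod (fst x) = 1 \<and> cmod (snd x) = 1"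
  obtain z w where [simp]: "x = (z, w)" by (cases x)
  have "z \<noteq> 0" "w \<noteq> 0" "cnj (z powi k) = z powi (- k)" "cnj (w powi l) = w powi (- l)"
    using x by (auto intro!: cnj_power_int_unimodular simp del: complex_cnj_power_int)
  then show "monomial i j x * cnj (monomial k l x) = monomial (i - k) (j - l) x"
    by (simp add: monomial_def power_int_diff power_int_minus field_simps del: complex_cnj_power_int)
qed

lemma fourier_monomial: "fourier (monomial i j) k l = (if i = k \<and> j = l then 1 else 0)"
proof -
  have "fourier (monomial i j) k l = (\<integral>x. monomial (i - k) (j - l) x \<partial>torus)"
    unfolding inner_L2_def by (rule integral_cong_AE[OF _ _ monomial_mult_cnj]) measurable
  also have "\<dots> = (\<integral>w. (\<integral>z. z powi (i - k) * w powi (j - l) \<partial>circle) \<partial>circle)"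
    using torus_Fubini(1)[of "monomial (i - k) (j - l)"]
      integrable_mult_cnj[OF monomial_L2[of "i - k" "j - l"] monomial_L2[of 0 0]]
    by (simp add: monomial_def case_prod_unfold)
  also have "\<dots> = (if i = k \<and> j = l then 1 else 0)"
    by (simp add: integral_circle_power_int)
  finally show ?thesis .
qed

lemma L2_mult_monomial: "f \<in> L2 torus \<Longrightarrow> (\<lambda>x. monomial i j x * f x) \<in> L2 torus"
  by (rule L2_mult_unimodular[OF _ monomial_measurable monomial_norm])

lemma inner_mult_monomial:
  assumes "f \<in> L2 torus" "g \<in> L2 torus"
  shows "inner_L2 torus (\<lambda>x. monomial i j x * f x) g = inner_L2 torus f (\<lambda>x. monomial (- i) (- j) x * g x)"
  unfolding inner_L2_def
proof (rule integral_cong_AE)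
  have [measurable]: "f \<in> borel_measurable torus" "g \<in> borel_measurable torus"
    using assms by (auto simp: L2_iff)
  show "(\<lambda>x. monomial i j x * f x * cnj (g x)) \<in> borel_measurable torus"
    "(\<lambda>x. f x * cnj (monomial (- i) (- j) x * g x)) \<in> borel_measurable torus" by measurable
  show "AE x in torus. monomial i j x * f x * cnj (g x) = f x * cnj (monomial (- i) (- j) x * g x)"
    using monomial_mult_cnj[of 0 0 "-i" "-j"]
    by eventually_elim (simp add: monomial_def case_prod_unfold)
qed

text \<open>
  Multiplication by a monomial shifts the Fourier coefficients.
\<close>

lemma fourier_mult_monomial:
  assumes f: "f \<in> L2 torus"
  shows "fourier (\<lambda>x. monomial i j x * f x) k l = fourier f (k - i) (l - j)"
proof -
  have "fourier (\<lambda>x. monomial i j x * f x) k l = inner_L2 torus f (\<lambda>x. monomial (- i) (- j) x * monomial k l x)"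
    by (rule inner_mult_monomial[OF f monomial_L2])
  also have "\<dots> = fourier f (k - i) (l - j)"
    unfolding inner_L2_def
  proof (rule integral_cong_AE)
    have [measurable]: "f \<in> borel_measurable torus" using f by (auto simp: L2_iff)
    show "(\<lambda>x. f x * cnj (monomial (- i) (- j) x * monomial k l x)) \<in> borel_measurable torus"
      "(\<lambda>x. f x * cnj (monomial (k - i) (l - j) x)) \<in> borel_measurable torus" by measurable
    have "AE x in torus. monomial (- i) (- j) x * monomial k l x = monomial (k - i) (l - j) x"
      using AE_torus_norm
    proof eventually_elim
      fix x :: "complex \<times> complex" assume "cmod (fst x) = 1 \<and> cmod (snd x) = 1"
      then have "fst x \<noteq> 0" "snd x \<noteq> 0" by auto
      then show "monomial (- i) (- j) x * monomial k l x = monomial (k - i) (l - j) x"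
        by (simp add: monomial_def case_prod_unfold power_int_diff power_int_minus field_simps)
    qed
    then show "AE x in torus. f x * cnj (monomial (- i) (- j) x * monomial k l x)
        = f x * cnj (monomial (k - i) (l - j) x)"
      by eventually_elim simp
  qed
  finally show ?thesis .
qed

lemma hardy_torus_iff:
  "f \<in> hardy_torus \<longleftrightarrow> f \<in> L2 torus \<and> (\<forall>i j. i < 0 \<or> j < 0 \<longrightarrow> fourier f i j = 0)"
  by (simp add: hardy_torus_def monomial_def)

lemma hardy_mult_monomial:
  assumes "f \<in> hardy_torus" "0 \<le> i" "0 \<le> j"
  shows "(\<lambda>x. monomial i j x * f x) \<in> hardy_torus"
  using assms by (auto simp: hardy_torus_iff L2_mult_monomial fourier_mult_monomial)

section \<open>The space spanned by the homogeneous polynomials\<close>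

lemma p_poly_eq: "p_poly n = (\<lambda>x. \<Sum>i=0..n. 1 * monomial (int i) (int (n - i)) x)"
  by (simp add: p_poly_def monomial_def fun_eq_iff del: of_nat_diff)

lemma p_poly_L2: "p_poly n \<in> L2 torus" "range p_poly \<subseteq> L2 torus"
proof -
  show "p_poly n \<in> L2 torus" for n
    unfolding p_poly_eq by (intro L2_sum L2_scale monomial_L2)
  then show "range p_poly \<subseteq> L2 torus" by auto
qed

lemma fourier_p_poly:
  "fourier (p_poly n) k l = (if 0 \<le> k \<and> 0 \<le> l \<and> k + l = int n then 1 else 0)"
proof -
  have "fourier (p_poly n) k l = (\<Sum>i=0..n. 1 * fourier (monomial (int i) (int (n - i))) k l)"
    unfolding p_poly_eq by (rule inner_L2_comb_left) (rule monomial_L2)+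
  also have "\<dots> = (\<Sum>i=0..n. if i = nat k then (if 0 \<le> k \<and> 0 \<le> l \<and> k + l = int n then 1 else 0) else 0)"
    by (rule sum.cong) (auto simp: fourier_monomial)
  also have "\<dots> = (if 0 \<le> k \<and> 0 \<le> l \<and> k + l = int n then 1 else 0)"
    by (subst sum.delta) auto
  finally show ?thesis .
qed

lemma inner_p_poly:
  assumes "f \<in> L2 torus"
  shows "inner_L2 torus f (p_poly n) = (\<Sum>i=0..n. fourier f (int i) (int (n - i)))"
proof -
  have "inner_L2 torus (p_poly n) f = (\<Sum>i=0..n. 1 * inner_L2 torus (monomial (int i) (int (n - i))) f)"
    unfolding p_poly_eq by (rule inner_L2_comb_left) (use assms monomial_L2 in auto)
  from arg_cong[OF this, of cnj] show ?thesis
    by (simp flip: inner_L2_cnj)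
qed

lemma inner_p_poly_p_poly: "inner_L2 torus (p_poly n) (p_poly m) = (if n = m then of_nat (Suc n) else 0)"
  by (auto simp: inner_p_poly p_poly_L2 fourier_p_poly)

text \<open>
  The generators are polynomials, and the vanishing of a Fourier coefficient is a closed condition, so
  the closed span lies inside the Hardy space.
\<close>

lemma calH_eq: "calH = closed_span torus (range p_poly)"
proof -
  have "f \<in> hardy_torus" if f: "f \<in> closed_span torus (range p_poly)" for f
    unfolding hardy_torus_iff
  proof (intro conjI allI impI)
    show "f \<in> L2 torus" using f closed_span_L2 by blast
    fix i j :: int assume "i < 0 \<or> j < 0"
    then show "fourier f i j = 0"
      by (intro closed_span_orthogonal[OF p_poly_L2(2) monomial_L2 _ f]) (auto simp: fourier_p_poly)
  qed
  then show ?thesis by (auto simp: calH_def)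
qed

lemma calH_hardy: "f \<in> calH \<Longrightarrow> f \<in> hardy_torus"
  by (simp add: calH_def)

lemma calH_L2: "f \<in> calH \<Longrightarrow> f \<in> L2 torus"
  by (simp add: calH_def hardy_torus_iff)

lemma p_poly_calH: "p_poly n \<in> calH"
  unfolding calH_eq
  by (rule subsetD[OF complex_span_subset_closed_span[OF p_poly_L2(2)]]) (simp add: complex_span_base)

lemma calH_orthogonalI:
  assumes "g \<in> L2 torus" "\<And>n. inner_L2 torus g (p_poly n) = 0" "f \<in> calH"
  shows "inner_L2 torus f g = 0"
proof (rule closed_span_orthogonal[OF p_poly_L2(2) assms(1)])
  show "inner_L2 torus s g = 0" if "s \<in> range p_poly" for s
    using that assms(2) by (auto simp: inner_L2_cnj[of torus _ g])
qed (use assms(3) calH_eq in simp)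

text \<open>
  Members of the space are orthogonal to \<open>z\<^sup>i w\<^sup>j (z - w)\<close>: their Fourier coefficients depend
  only on the total degree.
\<close>

lemma fourier_calH_shift:
  assumes f: "f \<in> calH" and "0 \<le> i" "0 \<le> j"
  shows "fourier f (i + 1) j = fourier f i (j + 1)"
proof -
  have "inner_L2 torus f (\<lambda>x. monomial (i + 1) j x - monomial i (j + 1) x) = 0"
  proof (rule calH_orthogonalI[OF L2_diff[OF monomial_L2 monomial_L2] _ f])
    fix n
    have "inner_L2 torus (p_poly n) (\<lambda>x. monomial (i + 1) j x - monomial i (j + 1) x) = 0"
      using assms(2,3) by (simp add: inner_L2_diff_right monomial_L2 p_poly_L2 fourier_p_poly)
    then show "inner_L2 torus (\<lambda>x. monomial (i + 1) j x - monomial i (j + 1) x) (p_poly n) = 0"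
      by (subst inner_L2_cnj) simp
  qed
  then show ?thesis by (simp add: inner_L2_diff_right monomial_L2 calH_L2 f)
qed

text \<open>
  Multiplication by \<open>z\<close> and multiplication by \<open>w\<close> have the same effect on the inner products with
  the homogeneous polynomials. This is the identity behind \<open>P (z f) = P (w f)\<close>, where \<open>P\<close> is the
  projection onto their closed span.
\<close>

lemma inner_p_poly_mult_z:
  assumes u: "u \<in> hardy_torus"
  shows "inner_L2 torus (\<lambda>x. monomial 1 0 x * u x) (p_poly n) = (if n = 0 then 0 else inner_L2 torus u (p_poly (n - 1)))"
proof -
  have L: "u \<in> L2 torus" and neg: "\<And>i j. i < 0 \<Longrightarrow> fourier u i j = 0" using u by (auto simp: hardy_torus_iff)
  show ?thesis
  proof (cases n)
    case (Suc m)
    have "(\<Sum>i=0..Suc m. fourier u (int i - 1) (int (Suc m - i) - 0)) = (\<Sum>i=0..m. fourier u (int i) (int (m - i)))"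
      unfolding sum.atLeast0_atMost_Suc_shift by (simp add: neg)
    then show ?thesis
      unfolding Suc inner_p_poly[OF L] inner_p_poly[OF L2_mult_monomial[OF L]] fourier_mult_monomial[OF L]
      by simp
  qed (simp add: inner_p_poly L L2_mult_monomial fourier_mult_monomial neg)
qed

lemma inner_p_poly_mult_w:
  assumes u: "u \<in> hardy_torus"
  shows "inner_L2 torus (\<lambda>x. monomial 0 1 x * u x) (p_poly n) = (if n = 0 then 0 else inner_L2 torus u (p_poly (n - 1)))"
proof -
  have L: "u \<in> L2 torus" and neg: "\<And>i j. j < 0 \<Longrightarrow> fourier u i j = 0" using u by (auto simp: hardy_torus_iff)
  show ?thesis
  proof (cases n)
    case (Suc m)
    have "fourier u (int i) (int (Suc m - i) - 1) = fourier u (int i) (int (m - i))" if "i \<le> m" for i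
      using that by (simp add: of_nat_diff)
    then show ?thesis
      unfolding Suc inner_p_poly[OF L] inner_p_poly[OF L2_mult_monomial[OF L]] fourier_mult_monomial[OF L]
      by (simp add: sum.atLeast0_atMost_Suc neg)
  qed (simp add: inner_p_poly L L2_mult_monomial fourier_mult_monomial neg)
qed

section \<open>The Bergman shift\<close>

text \<open>
  The chosen projection is a genuine one because a nearest point exists: the polynomials
  \<open>p\<^sub>n\<close> are orthogonal with \<open>\<parallel>p\<^sub>n\<parallel>\<^sup>2 = n + 1\<close>, and the Riesz--Fischer theorem for
  the normalised ones supplies the projection.
\<close>

lemma proj_calH:
  assumes f: "f \<in> L2 torus"
  shows "proj_L2 torus calH f \<in> calH"
    and "h \<in> calH \<Longrightarrow> inner_L2 torus (\<lambda>x. f x - proj_L2 torus calH f x) h = 0"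
proof -
  define e where "e n x = complex_of_real (1 / sqrt (Suc n)) * p_poly n x" for n x
  have inner_e: "inner_L2 torus g (e n) = complex_of_real (1 / sqrt (Suc n)) * inner_L2 torus g (p_poly n)" for g n
    unfolding e_def inner_L2_scale_right by simp
  have e: "orthonormal_family torus UNIV e"
    unfolding orthonormal_family_def
  proof (intro conjI ballI)
    show "e n \<in> L2 torus" for n unfolding e_def by (intro L2_scale p_poly_L2)
    fix n m
    have "inner_L2 torus (e n) (e m) = complex_of_real (1 / sqrt (Suc m)) * (complex_of_real (1 / sqrt (Suc n)) * inner_L2 torus (p_poly n) (p_poly m))"
      unfolding inner_e unfolding e_def inner_L2_scale_left ..
    also have "\<dots> = (if n = m then 1 else 0)"
    proof -
      have "complex_of_real (sqrt (Suc n)) * complex_of_real (sqrt (Suc n)) = of_nat (Suc n)"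
        by (simp flip: of_real_mult del: of_nat_Suc)
      then show ?thesis by (simp add: inner_p_poly_p_poly del: of_nat_Suc) (auto simp: field_simps)
    qed
    finally show "inner_L2 torus (e n) (e m) = (if n = m then 1 else 0)" .
  qed
  obtain g where g: "g \<in> closed_span torus (range e)" "\<And>n. inner_L2 torus g (e n) = inner_L2 torus f (e n)"
    by (rule Riesz_Fischer[OF e, of "\<lambda>n. inner_L2 torus f (e n)" "(norm_L2 torus f)\<^sup>2"])
       (use Bessel_inequality[OF e _ _ f] in auto)
  have span: "complex_span (range e) \<subseteq> complex_span (range p_poly)"
  proof
    fix h assume "h \<in> complex_span (range e)"
    then obtain F c where F: "finite F" "F \<subseteq> UNIV" "h = (\<lambda>x. \<Sum>k\<in>F. c k * e k x)"
      by (rule complex_span_image_comb)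
    show "h \<in> complex_span (range p_poly)"
      unfolding F(3) e_def by (intro complex_span_sum complex_span_scale complex_span_base) auto
  qed
  have gH: "g \<in> calH"
    unfolding calH_eq
  proof (rule closed_spanI)
    show "g \<in> L2 torus" using g(1) closed_span_L2 by blast
    fix d :: real assume "d > 0"
    then show "\<exists>h\<in>complex_span (range p_poly). norm_L2 torus (\<lambda>x. g x - h x) < d"
      using closed_spanD[OF g(1)] span by blast
  qed
  have "inner_L2 torus (\<lambda>x. f x - g x) h = 0" if h: "h \<in> calH" for h
  proof -
    have "inner_L2 torus h (\<lambda>x. f x - g x) = 0"
    proof (rule calH_orthogonalI[OF L2_diff[OF f calH_L2[OF gH]] _ h])
      fix n
      have "inner_L2 torus g (p_poly n) = inner_L2 torus f (p_poly n)"
        using g(2)[of n] by (simp add: inner_e del: of_nat_Suc)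
      then show "inner_L2 torus (\<lambda>x. f x - g x) (p_poly n) = 0"
        by (simp add: inner_L2_diff_left f calH_L2 gH p_poly_L2)
    qed
    then show ?thesis by (subst inner_L2_cnj) simp
  qed
  with gH have "\<exists>g. g \<in> calH \<and> (\<forall>h\<in>calH. inner_L2 torus (\<lambda>x. f x - g x) h = 0)" by blast
  from someI_ex[OF this]
  show "proj_L2 torus calH f \<in> calH"
    and "h \<in> calH \<Longrightarrow> inner_L2 torus (\<lambda>x. f x - proj_L2 torus calH f x) h = 0"
    unfolding proj_L2_def by blast+
qed

lemma T_z_eq: "T_z f = (\<lambda>x. monomial 1 0 x * f x)"
  by (auto simp: T_z_def monomial_def)

lemma inner_p_poly_bergman_shift:
  assumes f: "f \<in> calH"
  shows "inner_L2 torus (bergman_shift f) (p_poly n) = (if n = 0 then 0 else inner_L2 torus f (p_poly (n - 1)))"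
proof -
  have T: "T_z f \<in> L2 torus" unfolding T_z_eq by (rule L2_mult_monomial[OF calH_L2[OF f]])
  have "inner_L2 torus (\<lambda>x. T_z f x - bergman_shift f x) (p_poly n) = 0"
    unfolding bergman_shift_def by (rule proj_calH(2)[OF T p_poly_calH])
  moreover have "bergman_shift f \<in> L2 torus"
    unfolding bergman_shift_def by (rule calH_L2[OF proj_calH(1)[OF T]])
  ultimately have "inner_L2 torus (bergman_shift f) (p_poly n) = inner_L2 torus (T_z f) (p_poly n)"
    by (simp add: inner_L2_diff_left T p_poly_L2)
  then show ?thesis unfolding T_z_eq by (simp add: inner_p_poly_mult_z calH_hardy f)
qed

lemma invariant_subspaceD:
  assumes "invariant_subspace X" "f \<in> X"
  shows "f \<in> calH" "bergman_shift f \<in> X"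
  using assms by (auto simp: invariant_subspace_def)

text \<open>
  The space is orthogonal to the multiples of \<open>z - w\<close>, so on it the compression of multiplication
  by \<open>z\<close> is also the compression of multiplication by \<open>w\<close>, and its powers are the compressions of
  the powers of \<open>w\<close>. Multiplication by \<open>w\<close>, unlike multiplication by \<open>z\<close>, acts on every slice
  with \<open>w\<close> fixed as a scalar.
\<close>

lemma inner_bergman_shift_power:
  assumes X: "invariant_subspace X" and r: "r \<in> X" and q: "q \<in> calH"
  shows "(bergman_shift ^^ m) r \<in> X \<and>
    inner_L2 torus q ((bergman_shift ^^ m) r) = inner_L2 torus q (\<lambda>x. monomial 0 (int m) x * r x)"
proof -
  have rH: "r \<in> hardy_torus" using invariant_subspaceD(1)[OF X r] by (rule calH_hardy)
  have *: "(bergman_shift ^^ m) r \<in> X \<and> (\<forall>n. inner_L2 torus ((bergman_shift ^^ m) r) (p_poly n)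
      = inner_L2 torus (\<lambda>x. monomial 0 (int m) x * r x) (p_poly n))" for m
  proof (induction m)
    case 0
    then show ?case using r by (simp add: monomial_def case_prod_unfold)
  next
    case (Suc m)
    have "(\<lambda>x. monomial 0 (int (Suc m)) x * r x) = (\<lambda>x. monomial 0 1 x * (monomial 0 (int m) x * r x))"
      by (simp add: monomial_def case_prod_unfold fun_eq_iff flip: of_nat_Suc)
    then show ?case
      using Suc invariant_subspaceD[OF X] hardy_mult_monomial[OF rH, of 0 "int m"]
      by (simp add: inner_p_poly_bergman_shift inner_p_poly_mult_w)
  qed
  have L: "(bergman_shift ^^ m) r \<in> L2 torus" "(\<lambda>x. monomial 0 (int m) x * r x) \<in> L2 torus"
    using * invariant_subspaceD(1)[OF X] r by (blast intro: calH_L2 L2_mult_monomial)+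
  have "inner_L2 torus q (\<lambda>x. (bergman_shift ^^ m) r x - monomial 0 (int m) x * r x) = 0"
    by (rule calH_orthogonalI[OF L2_diff[OF L] _ q])
       (simp add: inner_L2_diff_left L p_poly_L2 *)
  then show ?thesis using * by (simp add: inner_L2_diff_right L calH_L2 q)
qed

text \<open>
  The defining orthogonality of a wandering vector, restated with \<open>w\<^sup>m\<close> in place of the powers of
  the shift.
\<close>

lemma wandering_orthogonal:
  assumes X: "invariant_subspace X" and q: "q \<in> wandering X" and r: "r \<in> X" and "0 < m"
  shows "inner_L2 torus q (\<lambda>x. monomial 0 (int m) x * r x) = 0"
proof -
  obtain k where m: "m = Suc k" using assms(4) gr0_implies_Suc by blast
  have qH: "q \<in> calH" using q invariant_subspaceD(1)[OF X] by (auto simp: wandering_def)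
  have "inner_L2 torus q (bergman_shift ((bergman_shift ^^ k) r)) = 0"
    using q inner_bergman_shift_power[OF X r qH, of k] by (auto simp: wandering_def)
  then show ?thesis using inner_bergman_shift_power[OF X r qH, of m] by (simp add: m)
qed

section \<open>Slices\<close>

text \<open>
  The Fourier coefficients in the variable \<open>z\<close>, as functions of \<open>w\<close>. They turn out to be the
  entries of the fibre vector at \<open>w\<close>.
\<close>

definition slice_coeff :: "(complex \<times> complex \<Rightarrow> complex) \<Rightarrow> nat \<Rightarrow> complex \<Rightarrow> complex" where
  "slice_coeff q j w = inner_L2 circle (\<lambda>z. q (z, w)) (\<lambda>z. z ^ j)"

lemma slice_measurable:
  assumes "q \<in> borel_measurable torus"
  shows "(\<lambda>z. q (z, w)) \<in> borel_measurable circle"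
proof -
  have [measurable]: "q \<in> borel_measurable (circle \<Otimes>\<^sub>M circle)" using assms by (simp add: torus_def)
  show ?thesis by measurable
qed

lemma AE_slice_L2:
  assumes "q \<in> L2 torus"
  shows "AE w in circle. (\<lambda>z. q (z, w)) \<in> L2 circle"
proof -
  have "integrable torus (\<lambda>x. (cmod (q x))\<^sup>2)" using assms by (simp add: L2_iff)
  from torus_Fubini(3)[OF this] show ?thesis
    by eventually_elim (use assms slice_measurable in \<open>auto simp: L2_iff\<close>)
qed

lemma integral_monomial_slice:
  "(\<integral>z. monomial 0 m (z, w) * a z * b z \<partial>circle) = (\<integral>z. a z * b z \<partial>circle) * w powi m"
proof -
  have "(\<lambda>z. monomial 0 m (z, w) * a z * b z) = (\<lambda>z. w powi m * (a z * b z))"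
    by (simp add: monomial_def mult.assoc)
  then show ?thesis by (simp add: mult.commute)
qed

lemma slice_coeff_fourier:
  assumes q: "q \<in> L2 torus"
  shows "integrable circle (slice_coeff q j)"
    and "(\<integral>w. slice_coeff q j w * w powi m \<partial>circle) = fourier q (int j) (- m)"
proof -
  have int: "integrable torus (\<lambda>x. q x * cnj (monomial (int j) 0 x))"
    by (rule integrable_mult_cnj[OF q monomial_L2])
  have eq: "slice_coeff q j = (\<lambda>w. \<integral>z. q (z, w) * cnj (monomial (int j) 0 (z, w)) \<partial>circle)"
    by (simp add: slice_coeff_def inner_L2_def monomial_def fun_eq_iff)
  show "integrable circle (slice_coeff q j)"
    unfolding eq by (rule torus_Fubini(2)[OF int])
  have int': "integrable torus (\<lambda>x. monomial 0 m x * q x * cnj (monomial (int j) 0 x))"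
    by (rule integrable_mult_cnj[OF L2_mult_monomial[OF q] monomial_L2])
  have "(\<integral>w. slice_coeff q j w * w powi m \<partial>circle)
      = (\<integral>w. (\<integral>z. monomial 0 m (z, w) * q (z, w) * cnj (monomial (int j) 0 (z, w)) \<partial>circle) \<partial>circle)"
    unfolding eq integral_monomial_slice ..
  also have "\<dots> = fourier (\<lambda>x. monomial 0 m x * q x) (int j) 0"
    unfolding inner_L2_def by (rule torus_Fubini(1)[OF int'])
  finally show "(\<integral>w. slice_coeff q j w * w powi m \<partial>circle) = fourier q (int j) (- m)"
    by (simp add: fourier_mult_monomial[OF q])
qed

text \<open>
  A backward shift in \<open>w\<close> of the coefficient of \<open>z\<^sup>j\<close> is the coefficient of
  \<open>z\<^sup>j\<^sup>+\<^sup>1\<close>, because the double coefficients depend only on the total degree. The two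
  sides have equal Fourier coefficients in \<open>w\<close>.
\<close>

lemma slice_coeff_recursion:
  assumes q: "q \<in> calH"
  shows "AE w in circle. slice_coeff q (Suc j) w = (slice_coeff q j w - (\<integral>u. slice_coeff q j u \<partial>circle)) / w"
proof -
  have L: "q \<in> L2 torus" and neg: "\<And>i j. i < 0 \<or> j < 0 \<Longrightarrow> fourier q i j = 0"
    using calH_hardy[OF q] by (auto simp: hardy_torus_iff)
  \<comment> \<open>The recursion is multiplied by \<open>w\<close>, so that it becomes the vanishing of an integrable function.\<close>
  define C where "C = (\<integral>u. slice_coeff q j u \<partial>circle)"
  have C: "C = fourier q (int j) 0"
    using slice_coeff_fourier(2)[OF L, of j 0] by (simp add: C_def)
  note int = slice_coeff_fourier(1)[OF L]
  note intm = integrable_circle_mult_power_int[OF int]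
  have "AE w in circle. slice_coeff q (Suc j) w * w powi 1 - slice_coeff q j w + C = 0"
  proof (rule AE_circle_zeroI)
    show "integrable circle (\<lambda>w. slice_coeff q (Suc j) w * w powi 1 - slice_coeff q j w + C)"
      by (intro Bochner_Integration.integrable_add Bochner_Integration.integrable_diff intm int) simp
    fix m
    have Cm: "integrable circle (\<lambda>w. C * w powi m)"
      using integrable_circle_mult_power_int[of "\<lambda>_. C" m] by simp
    have "(\<integral>w. (slice_coeff q (Suc j) w * w powi 1 - slice_coeff q j w + C) * w powi m \<partial>circle)
        = (\<integral>w. slice_coeff q (Suc j) w * w powi (m + 1) - slice_coeff q j w * w powi m + C * w powi m \<partial>circle)"
    proof (rule integral_cong_AE)
      show "AE w in circle. (slice_coeff q (Suc j) w * w powi 1 - slice_coeff q j w + C) * w powi m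
        = slice_coeff q (Suc j) w * w powi (m + 1) - slice_coeff q j w * w powi m + C * w powi m"
        using AE_circle_nonzero by eventually_elim (simp add: power_int_add algebra_simps)
      have [measurable]: "slice_coeff q i \<in> borel_measurable circle" for i
        using int by (rule borel_measurable_integrable)
      show "(\<lambda>w. (slice_coeff q (Suc j) w * w powi 1 - slice_coeff q j w + C) * w powi m) \<in> borel_measurable circle"
        by measurable
      show "(\<lambda>w. slice_coeff q (Suc j) w * w powi (m + 1) - slice_coeff q j w * w powi m + C * w powi m)
        \<in> borel_measurable circle" by measurable
    qed
    also have "\<dots> = fourier q (int (Suc j)) (- (m + 1)) - fourier q (int j) (- m) + C * (if m = 0 then 1 else 0)"
      using intm Cm by (simp add: slice_coeff_fourier(2)[OF L] integral_circle_power_int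
          del: of_nat_Suc minus_add_distrib)
    also have "\<dots> = 0"
    proof (cases "m < 0")
      case True
      then have "fourier q (int j + 1) (- m - 1) = fourier q (int j) (- m - 1 + 1)"
        by (intro fourier_calH_shift[OF q]) auto
      moreover have "int j + 1 = int (Suc j)" "- m - 1 = - (m + 1)" "- (m + 1) + 1 = - m" by auto
      ultimately have "fourier q (int (Suc j)) (- (m + 1)) = fourier q (int j) (- m)"
        by (simp only:)
      then show ?thesis using True by (simp only:) simp
    next
      case False
      then show ?thesis by (simp add: neg C)
    qed
    finally show "(\<integral>w. (slice_coeff q (Suc j) w * w powi 1 - slice_coeff q j w + C) * w powi m \<partial>circle) = 0" .
  qed
  with AE_circle_nonzero show ?thesis
    unfolding C_def[symmetric]
  proof eventually_elim
    fix w :: complex assume w: "w \<noteq> 0" and "slice_coeff q (Suc j) w * w powi 1 - slice_coeff q j w + C = 0"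
    then have "slice_coeff q (Suc j) w * w = slice_coeff q j w - C" by (simp add: algebra_simps)
    then show "slice_coeff q (Suc j) w = (slice_coeff q j w - C) / w"
      using w by (simp add: field_simps)
  qed
qed

lemma AE_Lvec_eq:
  assumes q: "q \<in> calH"
  shows "AE w in circle. Lvec w q = (\<lambda>j. slice_coeff q j w)"
proof -
  have L: "q \<in> L2 torus" using q by (rule calH_L2)
  have [measurable]: "slice_coeff q j \<in> borel_measurable circle" for j
    using slice_coeff_fourier(1)[OF L] by (rule borel_measurable_integrable)
  \<comment> \<open>Measurability is carried along because the next shift subtracts a mean, and two functions equal
    almost everywhere have the same mean provided that both are measurable.\<close>
  have "(backward_shift ^^ j) (at_z0 q) \<in> borel_measurable circle \<and>
      (AE w in circle. (backward_shift ^^ j) (at_z0 q) w = slice_coeff q j w)" for j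
  proof (induction j)
    case 0
    have "at_z0 q = slice_coeff q 0"
      by (simp add: at_z0_def slice_coeff_def inner_L2_def fun_eq_iff)
    then show ?case by simp
  next
    case (Suc j)
    define f where "f = (backward_shift ^^ j) (at_z0 q)"
    have [measurable]: "f \<in> borel_measurable circle" and ae: "AE w in circle. f w = slice_coeff q j w"
      using Suc by (auto simp: f_def)
    have "(\<integral>u. f u \<partial>circle) = (\<integral>u. slice_coeff q j u \<partial>circle)"
      by (rule integral_cong_AE) (use ae in auto)
    then have "AE w in circle. backward_shift f w = slice_coeff q (Suc j) w"
      using ae slice_coeff_recursion[OF q, of j] by (auto simp: backward_shift_def elim: eventually_elim2)
    moreover have "backward_shift f \<in> borel_measurable circle"
      unfolding backward_shift_def by measurable
    ultimately show ?case by (simp add: f_def)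
  qed
  then have "AE w in circle. \<forall>j. (backward_shift ^^ j) (at_z0 q) w = slice_coeff q j w"
    by (simp add: AE_all_countable)
  then show ?thesis by eventually_elim (simp add: Lvec_def fun_eq_iff)
qed

lemma slice_complex_span:
  assumes "h \<in> complex_span (range p_poly)"
  shows "(\<lambda>z. h (z, w)) \<in> complex_span (range (\<lambda>j z. z ^ j))"
proof -
  obtain F c where F: "finite F" "F \<subseteq> UNIV" "h = (\<lambda>x. \<Sum>k\<in>F. c k * p_poly k x)"
    using assms by (rule complex_span_image_comb)
  have p: "(\<lambda>z. p_poly n (z, w)) = (\<lambda>z. \<Sum>i=0..n. w ^ (n - i) * z ^ i)" for n
    by (simp add: p_poly_def mult.commute)
  have "(\<lambda>z. p_poly n (z, w)) \<in> complex_span (range (\<lambda>j z. z ^ j))" for n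
    unfolding p by (intro complex_span_sum complex_span_base) auto
  then show ?thesis unfolding F(3) by (rule complex_span_sum)
qed

text \<open>
  Approximation in \<open>L\<^sup>2\<close> of the torus by polynomials gives, along a subsequence, approximation in
  \<open>L\<^sup>2\<close> of the circle on almost every slice. The slices of the approximants are polynomials
  in \<open>z\<close>.
\<close>

lemma AE_slice_closed_span:
  assumes q: "q \<in> calH"
  shows "AE w in circle. (\<lambda>z. q (z, w)) \<in> closed_span circle (range (\<lambda>j z. z ^ j))"
proof -
  have L: "q \<in> L2 torus" using q by (rule calH_L2)
  obtain s where s: "\<And>n. s n \<in> complex_span (range p_poly)"
      and lim: "(\<lambda>n. norm_L2 torus (\<lambda>x. q x - s n x)) \<longlonglongrightarrow> 0"
    using closed_span_approx[of q torus "range p_poly"] q unfolding calH_eq by blast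
  define D where "D n w = (\<integral>z. (cmod (q (z, w) - s n (z, w)))\<^sup>2 \<partial>circle)" for n w
  have sq: "integrable torus (\<lambda>x. (cmod (q x - s n x))\<^sup>2)" for n
    using L2_diff[OF L subsetD[OF complex_span_L2[OF p_poly_L2(2)] s]] by (simp add: L2_iff)
  have D: "integrable circle (D n)" "(\<integral>w. D n w \<partial>circle) = (norm_L2 torus (\<lambda>x. q x - s n x))\<^sup>2" for n
    using torus_Fubini(1,2)[OF sq[of n]] unfolding D_def[abs_def] norm_L2_power2 by auto
  have "norm (D n w) = D n w" for n w by (simp add: D_def)
  moreover have "(\<lambda>n. (norm_L2 torus (\<lambda>x. q x - s n x))\<^sup>2) \<longlonglongrightarrow> 0"
    using tendsto_power[OF lim, of 2] by simp
  ultimately have "(\<lambda>n. \<integral>w. norm (D n w) \<partial>circle) \<longlonglongrightarrow> 0" by (simp add: D(2))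
  from tendsto_L1_AE_subseq[OF D(1) this]
  obtain r where r: "AE w in circle. (\<lambda>n. D (r n) w) \<longlonglongrightarrow> 0" by blast
  from r AE_slice_L2[OF L] show ?thesis
  proof eventually_elim
    fix w assume lim: "(\<lambda>n. D (r n) w) \<longlonglongrightarrow> 0" and qw: "(\<lambda>z. q (z, w)) \<in> L2 circle"
    show "(\<lambda>z. q (z, w)) \<in> closed_span circle (range (\<lambda>j z. z ^ j))"
    proof (rule closed_span_lim[OF orthonormal_familyD(2)[OF orthonormal_power_circle] qw])
      show "(\<lambda>z. s (r n) (z, w)) \<in> complex_span (range (\<lambda>j z. z ^ j))" for n
        by (rule slice_complex_span[OF s])
      show "(\<lambda>n. norm_L2 circle (\<lambda>z. q (z, w) - s (r n) (z, w))) \<longlonglongrightarrow> 0"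
        using tendsto_real_sqrt[OF lim] by (simp add: norm_L2_def D_def)
    qed
  qed
qed

text \<open>
  The fibre vector at \<open>w\<close> is the coefficient sequence of the slice at \<open>w\<close>, so Parseval's identity
  on the circle computes inner products of fibre vectors.
\<close>

lemma AE_Lvec_inner:
  assumes q: "q \<in> calH" and r: "r \<in> calH"
  shows "AE w in circle. Lvec w q \<in> L2 counting \<and>
    inner_L2 counting (Lvec w q) (Lvec w r) = (\<integral>z. q (z, w) * cnj (r (z, w)) \<partial>circle)"
  using AE_Lvec_eq[OF q] AE_Lvec_eq[OF r] AE_slice_closed_span[OF q] AE_slice_L2[OF calH_L2[OF r]]
proof eventually_elim
  fix w assume eq: "Lvec w q = (\<lambda>j. slice_coeff q j w)" "Lvec w r = (\<lambda>j. slice_coeff r j w)"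
    and qw: "(\<lambda>z. q (z, w)) \<in> closed_span circle (range (\<lambda>j z. z ^ j))" and rw: "(\<lambda>z. r (z, w)) \<in> L2 circle"
  have "(\<lambda>z. q (z, w)) \<in> L2 circle" using qw closed_span_L2 by blast
  from fourier_coeffs_L2[OF orthonormal_power_circle this]
  have "Lvec w q \<in> L2 counting" by (simp add: eq slice_coeff_def)
  moreover have "inner_L2 counting (Lvec w q) (Lvec w r) = (\<integral>z. q (z, w) * cnj (r (z, w)) \<partial>circle)"
    using Parseval[OF orthonormal_power_circle qw rw]
    unfolding eq slice_coeff_def by (simp add: inner_L2_def[of circle "\<lambda>z. q (z, w)"])
  ultimately show "Lvec w q \<in> L2 counting \<and>
    inner_L2 counting (Lvec w q) (Lvec w r) = (\<integral>z. q (z, w) * cnj (r (z, w)) \<partial>circle)" by blast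
qed

section \<open>Orthonormality of the fibre vectors\<close>

lemma wandering_calH: "invariant_subspace X \<Longrightarrow> q \<in> wandering X \<Longrightarrow> q \<in> calH \<and> q \<in> X"
  by (auto simp: wandering_def invariant_subspace_def)

text \<open>
  The inner product of the slices is an integrable function of \<open>w\<close> whose Fourier coefficients are
  the inner products of \<open>q\<close> and \<open>r\<close> twisted by a power of \<open>w\<close>. For wandering vectors all of them
  vanish except the constant one, so the function is constant almost everywhere.
\<close>

lemma AE_Lvec_inner_wandering:
  assumes X: "invariant_subspace X" and q: "q \<in> wandering X" and r: "r \<in> wandering X"
  shows "AE w in circle. Lvec w q \<in> L2 counting \<and>
    inner_L2 counting (Lvec w q) (Lvec w r) = inner_L2 torus q r"
proof -
  have qX: "q \<in> calH" "q \<in> X" and rX: "r \<in> calH" "r \<in> X"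
    using wandering_calH[OF X] q r by auto
  have qL: "q \<in> L2 torus" and rL: "r \<in> L2 torus" using qX rX calH_L2 by auto
  define G where "G w = (\<integral>z. q (z, w) * cnj (r (z, w)) \<partial>circle)" for w
  define c where "c = inner_L2 torus q r"
  have G: "integrable circle G"
    unfolding G_def[abs_def] by (rule torus_Fubini(2)[OF integrable_mult_cnj[OF qL rL]])
  have Gm: "(\<integral>w. G w * w powi m \<partial>circle) = inner_L2 torus (\<lambda>x. monomial 0 m x * q x) r" for m
  proof -
    have "(\<integral>w. G w * w powi m \<partial>circle)
        = (\<integral>w. (\<integral>z. monomial 0 m (z, w) * q (z, w) * cnj (r (z, w)) \<partial>circle) \<partial>circle)"
      unfolding G_def integral_monomial_slice ..
    also have "\<dots> = inner_L2 torus (\<lambda>x. monomial 0 m x * q x) r"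
      unfolding inner_L2_def
      by (rule torus_Fubini(1)[OF integrable_mult_cnj[OF L2_mult_monomial[OF qL] rL]])
    finally show ?thesis .
  qed
  have Gm0: "(\<integral>w. G w * w powi m \<partial>circle) = (if m = 0 then c else 0)" for m
  proof -
    \<comment> \<open>A positive power of \<open>w\<close> falls on \<open>q\<close>; a negative one moves to \<open>r\<close> as a positive one.\<close>
    consider "m = 0" | "0 < m" | "m < 0" by linarith
    then show ?thesis
    proof cases
      case 1
      then show ?thesis unfolding Gm by (simp add: c_def monomial_def case_prod_unfold)
    next
      case 2
      then have "inner_L2 torus r (\<lambda>x. monomial 0 m x * q x) = 0"
        using wandering_orthogonal[OF X r qX(2), of "nat m"] by simp
      then show ?thesis using 2 unfolding Gm by (subst inner_L2_cnj) simp
    next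
      case 3
      then have "inner_L2 torus q (\<lambda>x. monomial 0 (- m) x * r x) = 0"
        using wandering_orthogonal[OF X q rX(2), of "nat (- m)"] by simp
      then show ?thesis using 3 unfolding Gm by (simp add: inner_mult_monomial[OF qL rL])
    qed
  qed
  have "AE w in circle. G w - c = 0"
  proof (rule AE_circle_zeroI)
    show "integrable circle (\<lambda>w. G w - c)" using G by simp
    fix m
    have "integrable circle (\<lambda>w. c * w powi m)"
      using integrable_circle_mult_power_int[of "\<lambda>_. c" m] by simp
    then show "(\<integral>w. (G w - c) * w powi m \<partial>circle) = 0"
      using integrable_circle_mult_power_int[OF G, of m]
      by (simp add: left_diff_distrib Gm0 integral_circle_power_int)
  qed
  with AE_Lvec_inner[OF qX(1) rX(1)] show ?thesis
    by eventually_elim (simp add: G_def c_def)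
qed

text \<open>
  Countability of the index set lets the null sets attached to pairs of indices be united. By Bessel's
  inequality each \<open>p\<^sub>n\<close> has a nonzero coefficient at only countably many indices, and a member of
  the system orthogonal to every \<open>p\<^sub>n\<close> would be zero.
\<close>

lemma orthonormal_calH_countable:
  assumes q: "orthonormal_family torus K q" and H: "\<And>k. k \<in> K \<Longrightarrow> q k \<in> calH"
  shows "countable K"
proof -
  define S where "S n = {k \<in> K. (cmod (inner_L2 torus (p_poly n) (q k)))\<^sup>2 \<noteq> 0}" for n
  have "countable (S n)" for n
  proof -
    have "(\<lambda>k. (cmod (inner_L2 torus (p_poly n) (q k)))\<^sup>2) summable_on K"
    proof (rule nonneg_bdd_above_summable_on)
      show "bdd_above (sum (\<lambda>k. (cmod (inner_L2 torus (p_poly n) (q k)))\<^sup>2) ` {F. F \<subseteq> K \<and> finite F})"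
        using Bessel_inequality[OF q _ _ p_poly_L2(1)] by (intro bdd_aboveI[of _ "(norm_L2 torus (p_poly n))\<^sup>2"]) auto
    qed simp
    then show ?thesis unfolding S_def by (rule summable_countable_real)
  qed
  moreover have "K \<subseteq> (\<Union>n. S n)"
  proof
    fix k assume k: "k \<in> K"
    show "k \<in> (\<Union>n. S n)"
    proof (rule ccontr)
      assume "k \<notin> (\<Union>n. S n)"
      then have "inner_L2 torus (p_poly n) (q k) = 0" for n using k by (auto simp: S_def)
      then have "inner_L2 torus (q k) (p_poly n) = 0" for n by (subst inner_L2_cnj) simp
      then have "inner_L2 torus (q k) (q k) = 0"
        by (rule calH_orthogonalI[OF calH_L2[OF H[OF k]] _ H[OF k]])
      then show False using orthonormal_familyD(3)[OF q k k] by simp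
    qed
  qed
  ultimately show ?thesis using countable_UN[of "UNIV :: nat set" S] countable_subset by blast
qed

lemma AE_orthonormal_Lvec:
  assumes X: "invariant_subspace X" and q: "orthonormal_basis torus K q (wandering X)"
  shows "AE w in circle. orthonormal_family counting K (\<lambda>k. Lvec w (q k))"
proof -
  have W: "q k \<in> wandering X" if "k \<in> K" for k using q that by (simp add: orthonormal_basis_def)
  have H: "q k \<in> calH" if "k \<in> K" for k using wandering_calH[OF X W[OF that]] by blast
  have on: "orthonormal_family torus K q"
    using q calH_L2[OF H] by (auto simp: orthonormal_family_def orthonormal_basis_def)
  have K: "countable K" by (rule orthonormal_calH_countable[OF on H])
  have "AE w in circle. Lvec w (q k) \<in> L2 counting \<and>
      inner_L2 counting (Lvec w (q k)) (Lvec w (q l)) = (if k = l then 1 else 0)" if "k \<in> K" "l \<in> K" for k l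
    using AE_Lvec_inner_wandering[OF X W[OF that(1)] W[OF that(2)]] orthonormal_familyD(3)[OF on that] by simp
  then have "AE w in circle. \<forall>k\<in>K. \<forall>l\<in>K. Lvec w (q k) \<in> L2 counting \<and>
      inner_L2 counting (Lvec w (q k)) (Lvec w (q l)) = (if k = l then 1 else 0)"
    by (simp add: AE_ball_countable[OF K])
  then show ?thesis by eventually_elim (auto simp: orthonormal_family_def)
qed

theorem theorem3p6:
  fixes M L N :: "(complex \<times> complex \<Rightarrow> complex) set"
    and K :: "'k set"
    and qM qL qN :: "'k \<Rightarrow> complex \<times> complex \<Rightarrow> complex"
  assumes "invariant_subspace M" and "invariant_subspace L" and "invariant_subspace N"
    and "N \<subseteq> L" and "L \<subseteq> M"
    and "orthonormal_basis torus K qM (wandering M)"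
    and "orthonormal_basis torus K qL (wandering L)"
    and "orthonormal_basis torus K qN (wandering N)"
  shows "AE w in circle.
    fibre_op K qM qN w = compose (fibre K qM w) (fibre_op K qL qN w) (fibre_op K qM qL w)"
  using AE_orthonormal_Lvec[OF assms(1,6)] AE_orthonormal_Lvec[OF assms(2,7)]
    AE_orthonormal_Lvec[OF assms(3,8)]
  by eventually_elim (rule fibre_op_compose)

end
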